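(* Let $H$ be a graded connected Hopf algebra over $\Bbbk$ with finite-dimensional homogeneous components $H_m$, let $S$ be its antipode, and let $h(t)=1+\sum_{m\ge1}(\dim H_m)\,t^m$. Then, as formal power series in $t$, $$\sum_{m\ge0}\operatorname{trace}\bigl(S|_{H_m}\bigr)\,t^m=\frac{h(t^2)}{h(t)}.$$
   Context: $\Bbbk$ is a field of characteristic zero. A graded connected Hopf algebra is a bialgebra $H$ with product $\mu$, coproduct $\Delta$, unit $1$, counit $\varepsilon$ and a decomposition $H=\bigoplus_{m\ge 0}H_m$ such that $\mu(H_p\otimes H_q)\subseteq H_{p+q}$, $\Delta(H_m)\subseteq\bigoplus_{p+q=m}H_p\otimes H_q$, $1\in H_0$, $\varepsilon(H_m)=0$ for $m>0$, and $\dim H_0=1$. It automatically has an antipode $S$, and $S(H_m)\subseteq H_m$ for all $m$. *)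

theory Defs
  imports
    "HOL-Computational_Algebra.Formal_Power_Series"
    "HOL-Library.Poly_Mapping"
    "HOL-Library.Set_Algebras"
begin

section \<open>Free vector spaces and tensor powers\<close>

text \<open>
  The free vector space on \<open>'x\<close> over \<open>'k\<close> is the type \<open>'x \<Rightarrow>\<^sub>0 'k\<close> of finitely supported functions.
\<close>

definition free_scale :: "'k::field \<Rightarrow> ('x \<Rightarrow>\<^sub>0 'k) \<Rightarrow> ('x \<Rightarrow>\<^sub>0 'k)" where
  "free_scale c p = Poly_Mapping.map ((*) c) p"

abbreviation gen :: "'x \<Rightarrow> ('x \<Rightarrow>\<^sub>0 'k::field)" where
  "gen x \<equiv> Poly_Mapping.single x 1"

definition free_extend ::
    "('k::field \<Rightarrow> 'v::ab_group_add \<Rightarrow> 'v) \<Rightarrow> ('x \<Rightarrow> 'v) \<Rightarrow> ('x \<Rightarrow>\<^sub>0 'k) \<Rightarrow> 'v" where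
  "free_extend s f p = (\<Sum>x\<in>Poly_Mapping.keys p. s (Poly_Mapping.lookup p x) (f x))"

lemma lookup_free_scale [simp]: "Poly_Mapping.lookup (free_scale c p) x = c * Poly_Mapping.lookup p x"
  by (simp add: free_scale_def Poly_Mapping.map.rep_eq when_def)

interpretation free: vector_space "free_scale :: 'k::field \<Rightarrow> ('x \<Rightarrow>\<^sub>0 'k) \<Rightarrow> _"
  by unfold_locales (auto intro!: poly_mapping_eqI simp: lookup_add algebra_simps)

lemma free_extend_superset:
  assumes "vector_space s" "finite A" "Poly_Mapping.keys p \<subseteq> A"
  shows "free_extend s f p = (\<Sum>x\<in>A. s (Poly_Mapping.lookup p x) (f x))"
proof -
  interpret vector_space s by fact
  show ?thesis unfolding free_extend_def
    by (rule sum.mono_neutral_left) (use assms in \<open>auto simp: in_keys_iff\<close>)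
qed

lemma linear_free_extend:
  fixes s :: "'k::field \<Rightarrow> 'v::ab_group_add \<Rightarrow> 'v" and f :: "'x \<Rightarrow> 'v"
  assumes "vector_space s"
  shows "Vector_Spaces.linear free_scale s (free_extend s f)"
proof -
  interpret vector_space s by fact
  interpret vector_space_pair "free_scale :: 'k \<Rightarrow> ('x \<Rightarrow>\<^sub>0 'k) \<Rightarrow> _" s by unfold_locales
  have add: "free_extend s f (p + q) = free_extend s f p + free_extend s f q" for p q
  proof -
    let ?A = "Poly_Mapping.keys p \<union> Poly_Mapping.keys q"
    have "Poly_Mapping.keys (p + q) \<subseteq> ?A" by (rule keys_add)
    then show ?thesis
      by (simp add: free_extend_superset[OF assms, of ?A] lookup_add scale_left_distrib sum.distrib)
  qed
  have sc: "free_extend s f (free_scale c p) = s c (free_extend s f p)" for c p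
  proof -
    have "Poly_Mapping.keys (free_scale c p) \<subseteq> Poly_Mapping.keys p" by (auto simp: in_keys_iff)
    then show ?thesis
      by (simp add: free_extend_superset[OF assms, of "Poly_Mapping.keys p"] scale_sum_right)
  qed
  show ?thesis by unfold_locales (fact add sc)+
qed

lemma free_extend_single [simp]:
  assumes "vector_space s" shows "free_extend s f (Poly_Mapping.single x c) = s c (f x)"
proof -
  interpret vector_space s by fact
  show ?thesis by (simp add: free_extend_superset[OF assms, of "{x}"])
qed

lemma coset_eq:
  assumes "free.subspace N" shows "(P +o N = Q +o N) = (P - Q \<in> N)"
proof
  assume "P +o N = Q +o N"
  moreover have "P \<in> P +o N" using free.subspace_0[OF assms] unfolding elt_set_plus_def by (metis (mono_tags, lifting) mem_Collect_eq add_0_right)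
  ultimately show "P - Q \<in> N" unfolding elt_set_plus_def by auto
next
  assume a: "P - Q \<in> N"
  have 1: "P + n \<in> Q +o N" if "n \<in> N" for n
    unfolding elt_set_plus_def using free.subspace_add[OF assms a that] by (force intro: bexI[of _ "P - Q + n"])
  have 2: "Q + n \<in> P +o N" if "n \<in> N" for n
    unfolding elt_set_plus_def using free.subspace_diff[OF assms that a] by (force intro: bexI[of _ "n - (P - Q)"])
  show "P +o N = Q +o N" using 1 2 unfolding elt_set_plus_def by blast
qed

text \<open>
  A slot \<open>\<sigma>\<close> fixes all but one tensor factor; the relations below are the linearity
  of the tensor symbol in the remaining factor.
\<close>

definition slot_relations ::
    "('k::field \<Rightarrow> 'h::ab_group_add \<Rightarrow> 'h) \<Rightarrow> ('h \<Rightarrow> 'x) \<Rightarrow> ('x \<Rightarrow>\<^sub>0 'k) set" where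
  "slot_relations s \<sigma> =
     {gen (\<sigma> (x + y)) - gen (\<sigma> x) - gen (\<sigma> y) | x y. True} \<union>
     {gen (\<sigma> (s c x)) - free_scale c (gen (\<sigma> x)) | c x. True}"

definition relations2 ::
    "('k::field \<Rightarrow> 'h::ab_group_add \<Rightarrow> 'h) \<Rightarrow> ('h \<times> 'h \<Rightarrow>\<^sub>0 'k) set" where
  "relations2 s = module.span free_scale
     ((\<Union>b. slot_relations s (\<lambda>x. (x, b))) \<union>
      (\<Union>a. slot_relations s (\<lambda>x. (a, x))))"

definition relations3 ::
    "('k::field \<Rightarrow> 'h::ab_group_add \<Rightarrow> 'h) \<Rightarrow> ('h \<times> 'h \<times> 'h \<Rightarrow>\<^sub>0 'k) set" where
  "relations3 s = module.span free_scale
     ((\<Union>b c. slot_relations s (\<lambda>x. (x, b, c))) \<union>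
      (\<Union>a c. slot_relations s (\<lambda>x. (a, x, c))) \<union>
      (\<Union>a b. slot_relations s (\<lambda>x. (a, b, x))))"

text \<open>
  \<open>H \<otimes> H\<close> and \<open>H \<otimes> H \<otimes> H\<close> are the quotients of the free vector spaces on pairs and triples by
  these subspaces. Their elements are cosets; the sum of two cosets is the sum of sets.
\<close>

definition tensor2 ::
    "('k::field \<Rightarrow> 'h::ab_group_add \<Rightarrow> 'h) \<Rightarrow> ('h \<times> 'h \<Rightarrow>\<^sub>0 'k) \<Rightarrow> ('h \<times> 'h \<Rightarrow>\<^sub>0 'k) set" where
  "tensor2 s P = P +o relations2 s"

definition tensor3 ::
    "('k::field \<Rightarrow> 'h::ab_group_add \<Rightarrow> 'h) \<Rightarrow> ('h \<times> 'h \<times> 'h \<Rightarrow>\<^sub>0 'k) \<Rightarrow> ('h \<times> 'h \<times> 'h \<Rightarrow>\<^sub>0 'k) set" where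
  "tensor3 s P = P +o relations3 s"

text \<open>
  Operations on the quotients are defined on representatives; a union over all
  representatives of a single coset has just one member when the operation respects the relations.
\<close>

definition tensor2_scale ::
    "('k::field \<Rightarrow> 'h::ab_group_add \<Rightarrow> 'h) \<Rightarrow> 'k \<Rightarrow> ('h \<times> 'h \<Rightarrow>\<^sub>0 'k) set \<Rightarrow> ('h \<times> 'h \<Rightarrow>\<^sub>0 'k) set" where
  "tensor2_scale s c A = (\<Union>P\<in>A. tensor2 s (free_scale c P))"

text \<open>The product determined by \<open>(a \<otimes> b) (c \<otimes> d) = a c \<otimes> b d\<close>.\<close>

definition tensor2_mult ::
    "('k::field \<Rightarrow> 'h::ring_1 \<Rightarrow> 'h) \<Rightarrow> ('h \<times> 'h \<Rightarrow>\<^sub>0 'k) set \<Rightarrow> ('h \<times> 'h \<Rightarrow>\<^sub>0 'k) set \<Rightarrow> ('h \<times> 'h \<Rightarrow>\<^sub>0 'k) set" where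
  "tensor2_mult s A B = (\<Union>P\<in>A. \<Union>Q\<in>B. tensor2 s
     (free_extend free_scale (\<lambda>(a, b).
        free_extend free_scale (\<lambda>(c, d). gen (a * c, b * d)) Q) P))"

text \<open>The linear map on \<open>H \<otimes> H\<close> induced by a bilinear map \<open>\<beta>\<close> into a vector space with scaling \<open>s'\<close>.\<close>

definition tensor2_lift ::
    "('k::field \<Rightarrow> 'v::ab_group_add \<Rightarrow> 'v) \<Rightarrow> ('h \<Rightarrow> 'h \<Rightarrow> 'v) \<Rightarrow> ('h \<times> 'h \<Rightarrow>\<^sub>0 'k) set \<Rightarrow> 'v" where
  "tensor2_lift s' \<beta> A = the_elem (free_extend s' (\<lambda>(a, b). \<beta> a b) ` A)"

lemma zero_rel: "0 \<in> relations2 s" "0 \<in> relations3 s"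
  by (auto simp: relations2_def relations3_def free.span_zero)

lemma free_extend_kernel:
  fixes t :: "'k::field \<Rightarrow> 'v::ab_group_add \<Rightarrow> 'v" and f :: "'x \<Rightarrow> 'v"
  assumes "vector_space t" "\<And>p. p \<in> X \<Longrightarrow> free_extend t f p = 0" "p \<in> free.span X"
  shows "free_extend t f p = 0"
proof -
  interpret vector_space t by fact
  interpret vector_space_pair "free_scale :: 'k \<Rightarrow> ('x \<Rightarrow>\<^sub>0 'k) \<Rightarrow> _" t by unfold_locales
  show ?thesis
    by (rule linear_eq_0_on_span[OF linear_free_extend[OF assms(1)] _ assms(3)]) (rule assms(2))
qed


lemma coset_map:
  fixes F :: "('x \<Rightarrow>\<^sub>0 'k::field) \<Rightarrow> 'v::ab_group_add"
  assumes "\<And>p q. F (p + q) = F p + F q" "\<And>R. R \<in> N \<Longrightarrow> F R = 0" "0 \<in> N"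
  shows "F ` (P +o N) = {F P}"
proof -
  have "F P \<in> F ` (P +o N)" using assms(3) unfolding elt_set_plus_def by (metis (mono_tags, lifting) mem_Collect_eq add_0_right image_eqI)
  moreover have "y = F P" if "y \<in> F ` (P +o N)" for y 
  proof -
    from that obtain R where "R \<in> N" "y = F (P + R)" unfolding elt_set_plus_def by blast
    then show ?thesis by (simp only: assms(1) assms(2) add_0_right)
  qed
  ultimately show ?thesis by blast
qed

text \<open>The universal property: a bilinear map factors through the quotient.\<close>

lemma tensor2_lift_tensor2:
  assumes s: "vector_space s" and t: "vector_space t"
    and l: "\<And>b. Vector_Spaces.linear s t (\<lambda>a. \<beta> a b)" and r: "\<And>a. Vector_Spaces.linear s t (\<beta> a)"
  shows "tensor2_lift t \<beta> (tensor2 s P) = free_extend t (\<lambda>(a,b). \<beta> a b) P"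
proof -
  interpret t: vector_space t by fact
  interpret fe: Vector_Spaces.linear free_scale t "free_extend t (\<lambda>(a,b). \<beta> a b)" by (rule linear_free_extend[OF t])
  note L = module_hom.add[OF l[unfolded linear_iff_module_hom]] module_hom.scale[OF l[unfolded linear_iff_module_hom]]
  note R = module_hom.add[OF r[unfolded linear_iff_module_hom]] module_hom.scale[OF r[unfolded linear_iff_module_hom]]
  have z: "free_extend t (\<lambda>(a,b). \<beta> a b) R = 0" if "R \<in> relations2 s" for R
  proof (rule free_extend_kernel[OF t])
    show "R \<in> free.span ((\<Union>b. slot_relations s (\<lambda>x. (x, b))) \<union> (\<Union>a. slot_relations s (\<lambda>x. (a, x))))"
      using that by (simp only: relations2_def)
  next
    fix p assume "p \<in> (\<Union>b. slot_relations s (\<lambda>x. (x, b))) \<union> (\<Union>a. slot_relations s (\<lambda>x. (a, x)))"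
    then consider
      (1) b x y where "p = gen (x + y, b) - gen (x, b) - gen (y, b)"
    | (2) b c x where "p = gen (s c x, b) - free_scale c (gen (x, b))"
    | (3) b x y where "p = gen (b, x + y) - gen (b, x) - gen (b, y)"
    | (4) b c x where "p = gen (b, s c x) - free_scale c (gen (b, x))"
      unfolding slot_relations_def by blast
    then show "free_extend t (\<lambda>(a,b). \<beta> a b) p = 0"
    proof cases
      case 1 then show ?thesis by (simp add: fe.diff free_extend_single[OF t] L(1))
    next
      case 2 then show ?thesis by (simp add: fe.diff fe.scale free_extend_single[OF t] L(2))
    next
      case 3 then show ?thesis by (simp add: fe.diff free_extend_single[OF t] R(1))
    next
      case 4 then show ?thesis by (simp add: fe.diff fe.scale free_extend_single[OF t] R(2))
    qed
  qed
  show ?thesis unfolding tensor2_lift_def tensor2_def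
    using coset_map[of "free_extend t (\<lambda>(a,b). \<beta> a b)", OF fe.add z zero_rel(1)] by simp
qed

text \<open>
  The maps \<open>D \<otimes> id\<close> and \<open>id \<otimes> D\<close> from \<open>H \<otimes> H\<close> to \<open>H \<otimes> H \<otimes> H\<close>, for a linear
  \<open>D : H \<rightarrow> H \<otimes> H\<close>. The choice of a representative of \<open>D a\<close> does not affect the resulting coset.
\<close>

definition tensor_map_left ::
    "('k::field \<Rightarrow> 'h::ab_group_add \<Rightarrow> 'h) \<Rightarrow> ('h \<Rightarrow> ('h \<times> 'h \<Rightarrow>\<^sub>0 'k) set) \<Rightarrow>
     ('h \<times> 'h \<Rightarrow>\<^sub>0 'k) set \<Rightarrow> ('h \<times> 'h \<times> 'h \<Rightarrow>\<^sub>0 'k) set" where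
  "tensor_map_left s D A = (\<Union>P\<in>A. tensor3 s
     (free_extend free_scale (\<lambda>(a, b).
        free_extend free_scale (\<lambda>(x, y). gen (x, y, b)) (SOME Q. Q \<in> D a)) P))"

definition tensor_map_right ::
    "('k::field \<Rightarrow> 'h::ab_group_add \<Rightarrow> 'h) \<Rightarrow> ('h \<Rightarrow> ('h \<times> 'h \<Rightarrow>\<^sub>0 'k) set) \<Rightarrow>
     ('h \<times> 'h \<Rightarrow>\<^sub>0 'k) set \<Rightarrow> ('h \<times> 'h \<times> 'h \<Rightarrow>\<^sub>0 'k) set" where
  "tensor_map_right s D A = (\<Union>P\<in>A. tensor3 s
     (free_extend free_scale (\<lambda>(a, b).
        free_extend free_scale (\<lambda>(x, y). gen (a, x, y)) (SOME Q. Q \<in> D b)) P))"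

section \<open>Bialgebras and antipodes\<close>

locale assoc_algebra = vector_space scale
  for scale :: "'k::field \<Rightarrow> 'h::ring_1 \<Rightarrow> 'h" +
  assumes mult_scale_left: "scale c x * y = scale c (x * y)"
    and mult_scale_right: "x * scale c y = scale c (x * y)"

locale coalgebra = vector_space scale
  for scale :: "'k::field \<Rightarrow> 'h::ab_group_add \<Rightarrow> 'h" +
  fixes \<Delta> :: "'h \<Rightarrow> ('h \<times> 'h \<Rightarrow>\<^sub>0 'k) set"
    and \<epsilon> :: "'h \<Rightarrow> 'k"
  assumes comult_closed: "\<Delta> x \<in> range (tensor2 scale)"
    and comult_add: "\<Delta> (x + y) = \<Delta> x + \<Delta> y"
    and comult_scale: "\<Delta> (scale c x) = tensor2_scale scale c (\<Delta> x)"
    and counit_linear: "Vector_Spaces.linear scale (*) \<epsilon>"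
    and coassoc: "tensor_map_left scale \<Delta> (\<Delta> x) = tensor_map_right scale \<Delta> (\<Delta> x)"
    and counit_left: "tensor2_lift scale (\<lambda>a b. scale (\<epsilon> a) b) (\<Delta> x) = x"
    and counit_right: "tensor2_lift scale (\<lambda>a b. scale (\<epsilon> b) a) (\<Delta> x) = x"

locale bialgebra = assoc_algebra scale + coalgebra scale \<Delta> \<epsilon>
  for scale :: "'k::field \<Rightarrow> 'h::ring_1 \<Rightarrow> 'h"
    and \<Delta> :: "'h \<Rightarrow> ('h \<times> 'h \<Rightarrow>\<^sub>0 'k) set"
    and \<epsilon> :: "'h \<Rightarrow> 'k" +
  assumes comult_mult: "\<Delta> (x * y) = tensor2_mult scale (\<Delta> x) (\<Delta> y)"
    and comult_one: "\<Delta> 1 = tensor2 scale (gen (1, 1))"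
    and counit_mult: "\<epsilon> (x * y) = \<epsilon> x * \<epsilon> y"
    and counit_one: "\<epsilon> 1 = 1"
begin

text \<open>The convolution product \<open>\<mu> \<circ> (f \<otimes> g) \<circ> \<Delta>\<close> of linear endomorphisms.\<close>

definition convolution :: "('h \<Rightarrow> 'h) \<Rightarrow> ('h \<Rightarrow> 'h) \<Rightarrow> 'h \<Rightarrow> 'h" where
  "convolution f g x = tensor2_lift scale (\<lambda>a b. f a * g b) (\<Delta> x)"

definition is_antipode :: "('h \<Rightarrow> 'h) \<Rightarrow> bool" where
  "is_antipode S \<longleftrightarrow> Vector_Spaces.linear scale scale S \<and>
     (\<forall>x. convolution S id x = scale (\<epsilon> x) 1) \<and>
     (\<forall>x. convolution id S x = scale (\<epsilon> x) 1)"

end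

section \<open>Gradings and traces\<close>

context vector_space
begin

definition graded_by :: "(nat \<Rightarrow> 'b set) \<Rightarrow> bool" where
  "graded_by H \<longleftrightarrow> (\<forall>m. subspace (H m)) \<and>
     (\<forall>x. \<exists>!f. (\<forall>m. f m \<in> H m) \<and> finite {m. f m \<noteq> 0} \<and> x = (\<Sum>m\<in>{m. f m \<noteq> 0}. f m))"

text \<open>
  The trace of the restriction of \<open>f\<close> to a finite-dimensional subspace \<open>V\<close> with \<open>f ` V \<subseteq> V\<close>:
  the sum of the diagonal coefficients with respect to a basis of \<open>V\<close>, whose choice is immaterial.
\<close>

definition trace_on :: "'b set \<Rightarrow> ('b \<Rightarrow> 'b) \<Rightarrow> 'a" where
  "trace_on V f =
     (let B = (SOME B. B \<subseteq> V \<and> independent B \<and> V \<subseteq> span B)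
      in \<Sum>b\<in>B. representation B (f b) b)"

end

text \<open>
  No antipode is required: in the connected case it exists automatically.
  In \<open>comult_graded\<close> the right-hand side is the sum of the subspaces \<open>H p \<otimes> H q\<close>, \<open>p + q = m\<close>.
\<close>

locale graded_connected_hopf_algebra = bialgebra scale \<Delta> \<epsilon>
  for scale :: "'k::field \<Rightarrow> 'h::ring_1 \<Rightarrow> 'h"
    and \<Delta> :: "'h \<Rightarrow> ('h \<times> 'h \<Rightarrow>\<^sub>0 'k) set"
    and \<epsilon> :: "'h \<Rightarrow> 'k" +
  fixes H :: "nat \<Rightarrow> 'h set"
  assumes grading: "graded_by H"
    and mult_graded: "x \<in> H p \<Longrightarrow> y \<in> H q \<Longrightarrow> x * y \<in> H (p + q)"
    and comult_graded: "x \<in> H m \<Longrightarrow>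
      \<Delta> x \<in> tensor2 scale ` {P. Poly_Mapping.keys P \<subseteq> (\<Union>(p, q)\<in>{(p, q). p + q = m}. H p \<times> H q)}"
    and one_graded: "1 \<in> H 0"
    and counit_graded: "m > 0 \<Longrightarrow> x \<in> H m \<Longrightarrow> \<epsilon> x = 0"
    and connected: "dim (H 0) = 1"

end

theory Submission
  imports Defs
begin

text \<open>
  After multiplication by \<open>h(t)\<close> the coefficient of \<open>t^m\<close> on the left is
  \<open>\<Sum>\<^sub>p\<^sub>+\<^sub>q\<^sub>=\<^sub>m dim H\<^sub>p \<cdot> trace (S|H\<^sub>q)\<close>, the trace of \<open>id \<otimes> S\<close> on the component of degree \<open>m\<close> of \<open>H \<otimes> H\<close>.
  The coefficient of \<open>t^m\<close> in \<open>h(t^2)\<close> is the trace on the same space of the flip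
  \<open>\<tau> (a \<otimes> b) = b \<otimes> a\<close>: only the basis vectors \<open>x \<otimes> x\<close> contribute to it. So the claim is that \<open>id \<otimes> S\<close>
  and \<open>\<tau>\<close> have the same trace in each degree.

  The link between them is the Galois map \<open>\<beta> (a \<otimes> b) = a\<^sub>1 \<otimes> a\<^sub>2 b\<close>, which has the inverse
  \<open>\<gamma> (a \<otimes> b) = a\<^sub>1 \<otimes> S(a\<^sub>2) b\<close>. With \<open>X (a \<otimes> b) = a\<^sub>1 b \<otimes> a\<^sub>2\<close> and \<open>U (a \<otimes> b) = a b\<^sub>1 \<otimes> S(b\<^sub>2)\<close>, the antipode
  axiom \<open>b\<^sub>1 S(b\<^sub>2) = \<epsilon>(b) 1\<close> gives \<open>\<beta> U = X\<close>, hence \<open>U = \<gamma> X\<close>. Now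
  \<open>trace (id \<otimes> S) = trace U = trace (\<gamma> X) = trace (\<gamma> \<tau> \<beta>) = trace \<tau>\<close>.

  The last equality is cyclicity of the trace (\<open>trace_wrt_cyclic\<close>). The first and the third compare
  two operators whose difference strictly raises a finite filtration, so that it has trace zero
  (\<open>trace_wrt_eq_if_diff_raises\<close>). In the first case the filtration is by the degree of the left factor:
  the term of \<open>U (a \<otimes> b)\<close> with \<open>b\<^sub>1 = 1\<close> is \<open>a \<otimes> S(b)\<close>, and all the others have a left factor of higher degree
  (\<open>antipode_twist_raises\<close>). In the third case it is the filtration by powers of the augmentation ideal,
  that is, by the number of factors of positive degree into which an element can be split. A
  homogeneous \<open>y\<close> of positive degree is primitive up to terms with two such factors, so \<open>\<Delta>\<close> is
  cocommutative to leading order (\<open>coord_comult_cocommutative_mod_length_filt\<close>); as \<open>X\<close> and \<open>\<tau> \<beta>\<close> differ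
  only by a flip of \<open>\<Delta> a\<close>, their difference raises this filtration (\<open>comult_left_raises\<close>). Finally, \<open>\<gamma>\<close> preserves
  the filtration because \<open>\<beta>\<close> does and is injective on finite-dimensional spaces
  (\<open>galois_inv_length_filt\<close>).

  Elements of \<open>H \<otimes> H\<close> are represented by their coordinates with respect to a homogeneous
  basis of \<open>H\<close>, so that traces can be read off; identities that involve the coproduct are computed as
  sums in Sweedler's notation \<open>\<Delta> x = \<Sum> x\<^sub>1 \<otimes> x\<^sub>2\<close>.
\<close>

section \<open>Traces with respect to a finite basis\<close>

lemma linear_span_in_subspace:
  assumes "Vector_Spaces.linear s t f" "x \<in> module.span s A" "module.subspace t U"
    and "\<And>a. a \<in> A \<Longrightarrow> f a \<in> U"
  shows "f x \<in> U"
proof -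
  interpret f: Vector_Spaces.linear s t f by fact
  have "x \<in> {x. f x \<in> U}"
    using assms(2) by (rule f.vs1.span_induct)
      (use assms(4) f.subspace_linear_preimage[OF assms(3)] in auto)
  then show ?thesis by simp
qed

text \<open>
  The basis is an argument here, so that a basis adapted to a filtration can be used.
\<close>

definition trace_wrt ::
    "('k::field \<Rightarrow> 'v::ab_group_add \<Rightarrow> 'v) \<Rightarrow> 'v set \<Rightarrow> ('v \<Rightarrow> 'v) \<Rightarrow> 'k" where
  "trace_wrt s B f = (\<Sum>b\<in>B. module.representation s B (f b) b)"

context vector_space
begin

text \<open>
  Expanding \<open>f\<close> and \<open>g\<close> in the two bases turns both sides into the same double sum of products of
  matrix entries. The two bases may belong to different subspaces, and with \<open>g\<close> the identity this
  gives independence of the basis.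
\<close>

lemma trace_wrt_cyclic:
  assumes B: "finite B" "independent B" and C: "finite C" "independent C"
    and f: "Vector_Spaces.linear scale scale f" and g: "Vector_Spaces.linear scale scale g"
    and gB: "g ` span B \<subseteq> span C" and fC: "f ` span C \<subseteq> span B"
  shows "trace_wrt scale B (\<lambda>x. f (g x)) = trace_wrt scale C (\<lambda>x. g (f x))"
proof -
  have expand: "representation B (f y) b
      = (\<Sum>c\<in>C. representation C y c * representation B (f c) b)"
    if B: "finite B" "independent B" and C: "finite C" "independent C"
      and f: "Vector_Spaces.linear scale scale f" and fC: "f ` span C \<subseteq> span B"
      and gx: "y \<in> span C" for B C f y b
  proof -
    interpret f: Vector_Spaces.linear scale scale f by fact
    have fc: "f c \<in> span B" if "c \<in> C" for c using fC that by (auto intro: span_base)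
    have "f y = f (\<Sum>c\<in>C. scale (representation C y c) c)"
      using sum_representation_eq[OF C(2) gx C(1)] by simp
    also have "\<dots> = (\<Sum>c\<in>C. scale (representation C y c) (f c))"
      by (simp add: f.sum f.scale)
    also have "representation B \<dots> b
        = (\<Sum>c\<in>C. representation C y c * representation B (f c) b)"
      using fc B(2) by (simp add: representation_sum representation_scale span_scale)
    finally show ?thesis .
  qed
  have gb: "g b \<in> span C" if "b \<in> B" for b using gB that by (auto intro: span_base)
  have fc: "f c \<in> span B" if "c \<in> C" for c using fC that by (auto intro: span_base)
  have "trace_wrt scale B (\<lambda>x. f (g x))
      = (\<Sum>b\<in>B. \<Sum>c\<in>C. representation C (g b) c * representation B (f c) b)"
    unfolding trace_wrt_def using expand[OF B C f fC gb] by simp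
  also have "\<dots> = (\<Sum>c\<in>C. \<Sum>b\<in>B. representation B (f c) b * representation C (g b) c)"
    by (subst sum.swap) (simp add: mult.commute)
  also have "\<dots> = trace_wrt scale C (\<lambda>x. g (f x))"
    unfolding trace_wrt_def using expand[OF C B g gB fc] by simp
  finally show ?thesis .
qed

corollary trace_wrt_basis_independent:
  assumes B: "finite B" "independent B" and C: "finite C" "independent C" and "span B = span C"
    and f: "Vector_Spaces.linear scale scale f" and "f ` span B \<subseteq> span B"
  shows "trace_wrt scale B f = trace_wrt scale C f"
  using trace_wrt_cyclic[OF B C f linear_ident] assms by simp

lemma finite_basis_exists:
  assumes "finite A"
  obtains B where "finite B" "independent B" "B \<subseteq> span A" "span B = span A"
proof -
  obtain B where B: "B \<subseteq> span A" "independent B" "span A \<subseteq> span B"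
    using maximal_independent_subset[of "span A"] by blast
  moreover have "finite B" using independent_span_bound[OF assms B(2,1)] by simp
  moreover have "span B = span A" using B span_mono[OF B(1)] by (auto simp: span_span)
  ultimately show ?thesis using that by blast
qed

text \<open>
  The image of a basis is independent; if it did not span, one more vector could be added, and
  there would be too many independent vectors.
\<close>

lemma injective_endo_surjective_on_span:
  assumes "finite A" and f: "Vector_Spaces.linear scale scale f"
    and into: "f ` span A \<subseteq> span A" and inj: "inj_on f (span A)"
  shows "f ` span A = span A"
proof -
  interpret f: Vector_Spaces.linear scale scale f by fact
  interpret vector_space_pair scale scale ..
  obtain B where B: "finite B" "independent B" "B \<subseteq> span A" "span B = span A"
    using finite_basis_exists[OF assms(1)] by blast
  have ind: "independent (f ` B)"
    using linear_independent_injective_image[OF f B(2)] inj B(4) by simp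
  have card: "card (f ` B) = card B"
    using inj B(3) by (meson card_image inj_on_subset)
  have "span A \<subseteq> span (f ` B)"
  proof (rule ccontr)
    assume "\<not> span A \<subseteq> span (f ` B)"
    then obtain v where v: "v \<in> span A" "v \<notin> span (f ` B)" by blast
    have "independent (insert v (f ` B))" using independent_insertI[OF v(2) ind] .
    moreover have "insert v (f ` B) \<subseteq> span B" using v B into by auto
    ultimately have "card (insert v (f ` B)) \<le> card B"
      using independent_span_bound[OF B(1)] by blast
    moreover have "v \<notin> f ` B" using v(2) span_base by blast
    ultimately show False using B(1) card by simp
  qed
  moreover have "span (f ` B) = f ` span A" using B(4) by (simp add: f.span_image)
  ultimately show ?thesis using into by blast
qed

text \<open>
  A basis of \<open>F (n + 1)\<close> extends to a basis of \<open>F n\<close>, starting from the empty basis of \<open>F N\<close>. In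
  the resulting basis of \<open>F 0\<close> the matrix of \<open>f\<close> is strictly triangular.
\<close>

lemma trace_wrt_filtration_raising:
  assumes A: "finite A" and f: "Vector_Spaces.linear scale scale f"
    and F: "\<And>n. subspace (F n)" "\<And>n. F (Suc n) \<subseteq> F n" "F 0 = span A" "F N = {0}"
    and raise: "\<And>n x. x \<in> F n \<Longrightarrow> f x \<in> F (Suc n)"
    and B: "finite B" "independent B" "span B = span A"
  shows "trace_wrt scale B f = 0"
proof -
  have "\<exists>C. independent C \<and> C \<subseteq> F n \<and> F n \<subseteq> span C \<and> (\<forall>c\<in>C. representation C (f c) c = 0)"
    if "n \<le> N" for n
    using that
  proof (induction n rule: inc_induct)
    case base
    show ?case by (rule exI[of _ "{}"]) (simp add: F(4) independent_empty)
  next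
    case (step n)
    then obtain C where C: "independent C" "C \<subseteq> F (Suc n)" "F (Suc n) \<subseteq> span C"
        "\<forall>c\<in>C. representation C (f c) c = 0" by blast
    have "C \<subseteq> F n" using C(2) F(2) by (rule order_trans)
    then obtain D where D: "C \<subseteq> D" "D \<subseteq> F n" "independent D" "F n \<subseteq> span D"
      using C(1) by (rule maximal_independent_subset_extend)
    have "representation D (f d) d = 0" if "d \<in> D" for d
    proof -
      \<comment> \<open>For \<open>d\<close> outside \<open>C\<close> the coefficient vanishes because \<open>f d\<close> only involves vectors of \<open>C\<close>.\<close>
      have "f d \<in> span C" using that D(2) raise C(3) by blast
      then have "representation D (f d) = representation C (f d)"
        using representation_extend[OF D(3) _ D(1)] by simp
      then show ?thesis using C(4) representation_ne_zero by metis
    qed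
    then show ?case using D by blast
  qed
  from this[of 0] obtain C where C: "independent C" "C \<subseteq> span A" "span A \<subseteq> span C"
      "\<forall>c\<in>C. representation C (f c) c = 0" using F(3) by auto
  have fC: "finite C" using independent_span_bound[OF A C(1,2)] by simp
  have eq: "span B = span C" using B(3) C(2,3) span_mono[OF C(2)] by (auto simp: span_span)
  have "f ` span B \<subseteq> span B" using raise[of _ 0] F(2)[of 0] F(3) B(3) by auto
  then have "trace_wrt scale B f = trace_wrt scale C f"
    using trace_wrt_basis_independent[OF B(1,2) fC C(1) eq f] by simp
  also have "\<dots> = 0" unfolding trace_wrt_def using C(4) by simp
  finally show ?thesis .
qed

lemma trace_wrt_eq_if_diff_raises:
  assumes A: "finite A" and f: "Vector_Spaces.linear scale scale f" and g: "Vector_Spaces.linear scale scale g"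
    and F: "\<And>n. subspace (F n)" "\<And>n. F (Suc n) \<subseteq> F n" "F 0 = span A" "F N = {0}"
    and raise: "\<And>n x. x \<in> F n \<Longrightarrow> f x - g x \<in> F (Suc n)"
    and gA: "g ` span A \<subseteq> span A"
    and B: "finite B" "independent B" "span B = span A"
  shows "trace_wrt scale B f = trace_wrt scale B g"
proof -
  interpret vector_space_pair scale scale ..
  have fg: "f x - g x \<in> span B" "g x \<in> span B" if "x \<in> span B" for x
    using raise[of x 0] F(2)[of 0] that gA F(3) B(3) by auto
  have fB: "f x \<in> span B" if "x \<in> span B" for x
    using span_add[OF fg(1)[OF that] fg(2)[OF that]] by simp
  have "trace_wrt scale B (\<lambda>x. f x - g x) = 0"
    by (rule trace_wrt_filtration_raising[where F=F, OF A module_hom_sub[OF f g] F raise B])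
  moreover have "trace_wrt scale B (\<lambda>x. f x - g x) = trace_wrt scale B f - trace_wrt scale B g"
    unfolding trace_wrt_def using fB fg(2)
    by (simp add: representation_diff[OF B(2)] span_base sum_subtractf)
  ultimately show ?thesis by simp
qed

end

section \<open>Sums over the coproduct\<close>

definition bilinear_map ::
    "('k::field \<Rightarrow> 'h::ab_group_add \<Rightarrow> 'h) \<Rightarrow> ('k \<Rightarrow> 'v::ab_group_add \<Rightarrow> 'v) \<Rightarrow> ('h \<Rightarrow> 'h \<Rightarrow> 'v) \<Rightarrow> bool" where
  "bilinear_map s t \<beta> \<longleftrightarrow>
     (\<forall>b. Vector_Spaces.linear s t (\<lambda>a. \<beta> a b)) \<and> (\<forall>a. Vector_Spaces.linear s t (\<beta> a))"

lemma linear_free_extend_compose: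
  assumes "Vector_Spaces.linear s t f"
  shows "f (free_extend s F P) = free_extend t (\<lambda>x. f (F x)) P"
proof -
  interpret Vector_Spaces.linear s t f by fact
  show ?thesis by (simp add: free_extend_def sum scale)
qed

lemma free_extend_add_fun:
  assumes "vector_space t"
  shows "free_extend t (\<lambda>x. F x + G x) P = free_extend t F P + free_extend t G P"
proof -
  interpret vector_space t by fact
  show ?thesis by (simp add: free_extend_def scale_right_distrib sum.distrib)
qed

lemma free_extend_swap:
  assumes "vector_space t"
  shows "free_extend t (\<lambda>x. free_extend t (\<lambda>y. F x y) Q) P = free_extend t (\<lambda>y. free_extend t (\<lambda>x. F x y) P) Q"
proof -
  interpret vector_space t by fact
  show ?thesis unfolding free_extend_def
    by (simp add: scale_sum_right mult.commute) (rule sum.swap)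
qed

lemma free_extend_in_subspace:
  assumes "vector_space t" "module.subspace t U" "\<And>x. x \<in> Poly_Mapping.keys P \<Longrightarrow> F x \<in> U"
  shows "free_extend t F P \<in> U"
proof -
  interpret vector_space t by fact
  show ?thesis unfolding free_extend_def
    by (intro subspace_sum[OF assms(2)] subspace_scale[OF assms(2)] assms(3))
qed

text \<open>
  The universal property of \<open>H \<otimes> H \<otimes> H\<close>, in the form needed to turn an equation between cosets of
  triples into an equation between sums.
\<close>

lemma free_extend_trilinear_relations3:
  assumes t: "vector_space t"
    and l: "\<And>b c. Vector_Spaces.linear s t (\<lambda>a. \<gamma> a b c)"
    and m: "\<And>a c. Vector_Spaces.linear s t (\<lambda>b. \<gamma> a b c)"
    and r: "\<And>a b. Vector_Spaces.linear s t (\<lambda>c. \<gamma> a b c)"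
    and R: "R \<in> relations3 s"
  shows "free_extend t (\<lambda>(a, b, c). \<gamma> a b c) R = 0"
proof -
  interpret t: vector_space t by fact
  interpret fe: Vector_Spaces.linear free_scale t "free_extend t (\<lambda>(a, b, c). \<gamma> a b c)"
    by (rule linear_free_extend[OF t])
  have slot: "free_extend t (\<lambda>(a, b, c). \<gamma> a b c) p = 0"
    if "p \<in> slot_relations s \<sigma>"
      and "Vector_Spaces.linear s t (\<lambda>x. (\<lambda>(a, b, c). \<gamma> a b c) (\<sigma> x))" for p \<sigma>
  proof -
    interpret l: Vector_Spaces.linear s t "\<lambda>x. (\<lambda>(a, b, c). \<gamma> a b c) (\<sigma> x)" by fact
    show ?thesis using that(1) unfolding slot_relations_def
      by (auto simp: fe.diff fe.scale free_extend_single[OF t] l.add l.scale)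
  qed
  have "R \<in> free.span ((\<Union>b c. slot_relations s (\<lambda>x. (x, b, c))) \<union>
      (\<Union>a c. slot_relations s (\<lambda>x. (a, x, c))) \<union>
      (\<Union>a b. slot_relations s (\<lambda>x. (a, b, x))))"
    using R by (simp only: relations3_def)
  then show ?thesis
  proof (rule free_extend_kernel[OF t, rotated])
    fix p assume "p \<in> (\<Union>b c. slot_relations s (\<lambda>x. (x, b, c))) \<union>
      (\<Union>a c. slot_relations s (\<lambda>x. (a, x, c))) \<union>
      (\<Union>a b. slot_relations s (\<lambda>x. (a, b, x)))"
    then consider (1) b c where "p \<in> slot_relations s (\<lambda>x. (x, b, c))"
      | (2) a c where "p \<in> slot_relations s (\<lambda>x. (a, x, c))"
      | (3) a b where "p \<in> slot_relations s (\<lambda>x. (a, b, x))" by blast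
    then show "free_extend t (\<lambda>(a, b, c). \<gamma> a b c) p = 0"
    proof cases
      case 1 then show ?thesis by (rule slot) (use l in simp)
    next
      case 2 then show ?thesis by (rule slot) (use m in simp)
    next
      case 3 then show ?thesis by (rule slot) (use r in simp)
    qed
  qed
qed

context coalgebra
begin

lemma bilinear_mapI:
  assumes "vector_space t"
    and "\<And>a a' b. \<beta> (a + a') b = \<beta> a b + \<beta> a' b" "\<And>c a b. \<beta> (scale c a) b = t c (\<beta> a b)"
    and "\<And>a b b'. \<beta> a (b + b') = \<beta> a b + \<beta> a b'" "\<And>c a b. \<beta> a (scale c b) = t c (\<beta> a b)"
  shows "bilinear_map scale t \<beta>"
  unfolding bilinear_map_def Vector_Spaces.linear_iff using assms vector_space_axioms by auto

lemma bilinear_mapD: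
  assumes "bilinear_map scale t \<beta>"
  shows "vector_space t"
    and "\<beta> (a + a') b = \<beta> a b + \<beta> a' b" "\<beta> (scale c a) b = t c (\<beta> a b)"
    and "\<beta> a (b + b') = \<beta> a b + \<beta> a b'" "\<beta> a (scale c b) = t c (\<beta> a b)"
    "Vector_Spaces.linear scale t (\<beta> a)" "Vector_Spaces.linear scale t (\<lambda>a. \<beta> a b)"
  using assms unfolding bilinear_map_def Vector_Spaces.linear_iff by auto

definition some_rep :: "'h \<Rightarrow> ('h \<times> 'h \<Rightarrow>\<^sub>0 'k)" where
  "some_rep x = (SOME P. P \<in> \<Delta> x)"

text \<open>
  Sweedler's sum \<open>\<Sum> \<beta> x\<^sub>1 x\<^sub>2\<close> with values in an arbitrary vector space. Taking one fixed representative
  of \<open>\<Delta> x\<close>, instead of the induced map on cosets, makes additivity in \<open>\<beta>\<close>, interchange of two sums and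
  compatibility with linear maps hold for every \<open>\<beta>\<close>; bilinearity is only needed to change the
  representative (\<open>sweedler_eq\<close>).
\<close>

definition sweedler :: "('k \<Rightarrow> 'v::ab_group_add \<Rightarrow> 'v) \<Rightarrow> ('h \<Rightarrow> 'h \<Rightarrow> 'v) \<Rightarrow> 'h \<Rightarrow> 'v" where
  "sweedler t \<beta> x = free_extend t (\<lambda>(a, b). \<beta> a b) (some_rep x)"

lemma subspace_relations2: "free.subspace (relations2 s)"
  unfolding relations2_def by simp

lemma tensor2_self: "P \<in> tensor2 scale P"
  unfolding tensor2_def elt_set_plus_def using zero_rel(1) by force

text \<open>
  Cosets are equal as soon as one contains a representative of the other.
\<close>

lemma comult_eq_iff_mem: "P \<in> \<Delta> x \<longleftrightarrow> \<Delta> x = tensor2 scale P"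
proof -
  obtain Q where Q: "\<Delta> x = tensor2 scale Q" using comult_closed[of x] by blast
  have "P \<in> tensor2 scale Q \<longleftrightarrow> P - Q \<in> relations2 scale"
    unfolding tensor2_def elt_set_plus_def
    by (auto simp: algebra_simps intro!: bexI[of _ "P - Q"])
  also have "\<dots> \<longleftrightarrow> tensor2 scale P = tensor2 scale Q"
    unfolding tensor2_def by (rule coset_eq[OF subspace_relations2, symmetric])
  finally show ?thesis using Q by auto
qed

lemma some_rep_mem: "some_rep x \<in> \<Delta> x"
proof -
  obtain Q where "\<Delta> x = tensor2 scale Q" using comult_closed[of x] by blast
  then have "Q \<in> \<Delta> x" using comult_eq_iff_mem by blast
  then show ?thesis unfolding some_rep_def by (rule someI)
qed

lemma comult_some_rep: "\<Delta> x = tensor2 scale (some_rep x)"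
  using some_rep_mem comult_eq_iff_mem by blast

lemma tensor2_lift_comult:
  assumes "bilinear_map scale t \<beta>"
  shows "tensor2_lift t \<beta> (\<Delta> x) = sweedler t \<beta> x"
  unfolding sweedler_def
  by (subst comult_some_rep, rule tensor2_lift_tensor2[OF vector_space_axioms])
    (use assms in \<open>auto intro: bilinear_mapD\<close>)

lemma sweedler_eq:
  assumes "bilinear_map scale t \<beta>" "P \<in> \<Delta> x"
  shows "sweedler t \<beta> x = free_extend t (\<lambda>(a, b). \<beta> a b) P"
proof -
  have "sweedler t \<beta> x = tensor2_lift t \<beta> (tensor2 scale P)"
    using tensor2_lift_comult[OF assms(1)] assms(2) comult_eq_iff_mem by metis
  also have "\<dots> = free_extend t (\<lambda>(a, b). \<beta> a b) P"
    by (rule tensor2_lift_tensor2[OF vector_space_axioms]) (use assms in \<open>auto intro: bilinear_mapD\<close>)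
  finally show ?thesis .
qed

lemma linear_sweedler:
  assumes "Vector_Spaces.linear t u f"
  shows "f (sweedler t \<beta> x) = sweedler u (\<lambda>a b. f (\<beta> a b)) x"
  unfolding sweedler_def linear_free_extend_compose[OF assms] by (simp add: case_prod_unfold)

lemma sweedler_plus:
  assumes "vector_space t"
  shows "sweedler t (\<lambda>a b. \<beta> a b + \<gamma> a b) x = sweedler t \<beta> x + sweedler t \<gamma> x"
  unfolding sweedler_def free_extend_add_fun[OF assms, symmetric] by (simp add: case_prod_unfold)

lemma sweedler_swap:
  assumes "vector_space t"
  shows "sweedler t (\<lambda>a b. sweedler t (\<lambda>c d. \<beta> a b c d) y) x = sweedler t (\<lambda>c d. sweedler t (\<lambda>a b. \<beta> a b c d) x) y"
  unfolding sweedler_def case_prod_unfold by (rule free_extend_swap[OF assms])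

lemma sweedler_in_subspace:
  assumes "bilinear_map scale t \<beta>" "module.subspace t U" "P \<in> \<Delta> x"
    and "\<And>a b. (a, b) \<in> Poly_Mapping.keys P \<Longrightarrow> \<beta> a b \<in> U"
  shows "sweedler t \<beta> x \<in> U"
  unfolding sweedler_eq[OF assms(1,3)]
  by (rule free_extend_in_subspace) (use assms in \<open>auto intro: bilinear_mapD\<close>)

lemma sweedler_arg_linear:
  assumes \<beta>: "bilinear_map scale t \<beta>"
  shows "Vector_Spaces.linear scale t (sweedler t \<beta>)"
proof -
  note t = bilinear_mapD(1)[OF \<beta>]
  interpret fe: Vector_Spaces.linear free_scale t "free_extend t (\<lambda>(a, b). \<beta> a b)"
    by (rule linear_free_extend[OF t])
  have add: "sweedler t \<beta> (x + y) = sweedler t \<beta> x + sweedler t \<beta> y" for x y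
  proof -
    have "some_rep x + some_rep y \<in> \<Delta> (x + y)"
      unfolding comult_add using some_rep_mem by (rule set_plus_intro) (rule some_rep_mem)
    then show ?thesis
      using sweedler_eq[OF \<beta>] by (simp add: sweedler_def fe.add)
  qed
  have sc: "sweedler t \<beta> (scale c x) = t c (sweedler t \<beta> x)" for c x
  proof -
    have "tensor2 scale (free_scale c (some_rep x)) \<subseteq> \<Delta> (scale c x)"
      unfolding comult_scale tensor2_scale_def using some_rep_mem by blast
    moreover have "free_scale c (some_rep x) \<in> tensor2 scale (free_scale c (some_rep x))"
      by (rule tensor2_self)
    ultimately have "free_scale c (some_rep x) \<in> \<Delta> (scale c x)" by blast
    then show ?thesis
      using sweedler_eq[OF \<beta>] by (simp add: sweedler_def fe.scale)
  qed
  show ?thesis unfolding Vector_Spaces.linear_iff using add sc t vector_space_axioms by blast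
qed

lemma bilinear_map_sweedler:
  assumes t: "vector_space t"
    and l: "\<And>b c. Vector_Spaces.linear scale t (\<lambda>a. \<gamma> a b c)"
    and m: "\<And>a c. Vector_Spaces.linear scale t (\<lambda>b. \<gamma> a b c)"
    and r: "\<And>a b. Vector_Spaces.linear scale t (\<lambda>c. \<gamma> a b c)"
  shows "bilinear_map scale t (\<lambda>a b. sweedler t (\<gamma> a) b)"
proof -
  have "bilinear_map scale t (\<lambda>b c. \<gamma> a b c)" for a
    unfolding bilinear_map_def using m r by blast
  note lin = sweedler_arg_linear[OF this]
  show ?thesis
  proof (rule bilinear_mapI[OF t])
    show "sweedler t (\<gamma> (a + a')) b = sweedler t (\<gamma> a) b + sweedler t (\<gamma> a') b" for a a' b
    proof -
      have "\<gamma> (a + a') = (\<lambda>b c. \<gamma> a b c + \<gamma> a' b c)"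
        using l unfolding Vector_Spaces.linear_iff by (intro ext) simp
      then show ?thesis by (simp add: sweedler_plus[OF t])
    qed
    show "sweedler t (\<gamma> (scale k a)) b = t k (sweedler t (\<gamma> a) b)" for k a b
    proof -
      have "\<gamma> (scale k a) = (\<lambda>b c. t k (\<gamma> a b c))"
        using l unfolding Vector_Spaces.linear_iff by (intro ext) simp
      then show ?thesis by (simp add: linear_sweedler[OF vector_space.linear_scale_self[OF t]])
    qed
  qed (use lin in \<open>auto simp: Vector_Spaces.linear_iff\<close>)
qed

text \<open>
  In Sweedler's notation: \<open>\<Sum> \<gamma> x\<^sub>1\<^sub>1 x\<^sub>1\<^sub>2 x\<^sub>2 = \<Sum> \<gamma> x\<^sub>1 x\<^sub>2\<^sub>1 x\<^sub>2\<^sub>2\<close>. A representative of the left-hand side of the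
  coassociativity axiom lies in some coset on the right-hand side, and the map that \<open>\<gamma>\<close> induces on
  triples does not see the difference, which is a relation.
\<close>

lemma sweedler_coassoc:
  assumes t: "vector_space t"
    and l: "\<And>b c. Vector_Spaces.linear scale t (\<lambda>a. \<gamma> a b c)"
    and m: "\<And>a c. Vector_Spaces.linear scale t (\<lambda>b. \<gamma> a b c)"
    and r: "\<And>a b. Vector_Spaces.linear scale t (\<lambda>c. \<gamma> a b c)"
  shows "sweedler t (\<lambda>a c. sweedler t (\<lambda>a b. \<gamma> a b c) a) x
       = sweedler t (\<lambda>a b. sweedler t (\<lambda>b c. \<gamma> a b c) b) x"
proof -
  let ?T = "free_extend t (\<lambda>(a, b, c). \<gamma> a b c)"
  interpret T: Vector_Spaces.linear free_scale t ?T by (rule linear_free_extend[OF t])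
  let ?L = "free_extend free_scale (\<lambda>(a, b).
        free_extend free_scale (\<lambda>(x, y). gen (x, y, b)) (SOME Q. Q \<in> \<Delta> a))"
  let ?R = "free_extend free_scale (\<lambda>(a, b).
        free_extend free_scale (\<lambda>(x, y). gen (a, x, y)) (SOME Q. Q \<in> \<Delta> b))"
  have TL: "?T (?L P) = free_extend t (\<lambda>(a, c). sweedler t (\<lambda>a b. \<gamma> a b c) a) P" for P
    unfolding linear_free_extend_compose[OF T.linear_axioms] sweedler_def some_rep_def
    by (simp add: case_prod_unfold linear_free_extend_compose[OF T.linear_axioms, unfolded case_prod_unfold] free_extend_single[OF t]
        module.scale_one[OF t[folded module_iff_vector_space]])
  have TR: "?T (?R P) = free_extend t (\<lambda>(a, b). sweedler t (\<lambda>b c. \<gamma> a b c) b) P" for P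
    unfolding linear_free_extend_compose[OF T.linear_axioms] sweedler_def some_rep_def
    by (simp add: case_prod_unfold linear_free_extend_compose[OF T.linear_axioms, unfolded case_prod_unfold] free_extend_single[OF t]
        module.scale_one[OF t[folded module_iff_vector_space]])
  have "?L (some_rep x) \<in> tensor3 scale (?L (some_rep x))"
    unfolding tensor3_def elt_set_plus_def using zero_rel(2) by force
  then have "?L (some_rep x) \<in> tensor_map_left scale \<Delta> (\<Delta> x)"
    unfolding tensor_map_left_def using some_rep_mem by blast
  then obtain P where P: "P \<in> \<Delta> x" "?L (some_rep x) \<in> tensor3 scale (?R P)"
    unfolding coassoc tensor_map_right_def by blast
  then obtain n where n: "n \<in> relations3 scale" "?L (some_rep x) = ?R P + n"
    unfolding tensor3_def elt_set_plus_def by blast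
  have "?T (?L (some_rep x)) = ?T (?R P)"
    unfolding n(2) T.add using free_extend_trilinear_relations3[OF t l m r n(1)] by simp
  moreover have "bilinear_map scale t (\<lambda>a b. sweedler t (\<lambda>b c. \<gamma> a b c) b)"
    by (rule bilinear_map_sweedler[OF t l m r])
  ultimately show ?thesis
    by (simp add: TL TR sweedler_eq[OF _ P(1)]) (simp add: sweedler_def)
qed

lemma sweedler_counit_left:
  assumes "Vector_Spaces.linear scale t f"
  shows "sweedler t (\<lambda>a b. t (\<epsilon> a) (f b)) x = f x"
proof -
  interpret \<epsilon>: Vector_Spaces.linear scale "(*)" \<epsilon> by (rule counit_linear)
  interpret f: Vector_Spaces.linear scale t f by fact
  have "bilinear_map scale scale (\<lambda>a b. scale (\<epsilon> a) b)"
    by (rule bilinear_mapI) (simp_all add: vector_space_axioms \<epsilon>.add \<epsilon>.scale scale_left_distrib scale_right_distrib mult.commute)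
  then have "x = sweedler scale (\<lambda>a b. scale (\<epsilon> a) b) x"
    using tensor2_lift_comult counit_left by metis
  then have "f x = f (sweedler scale (\<lambda>a b. scale (\<epsilon> a) b) x)" by simp
  then show ?thesis unfolding linear_sweedler[OF assms] f.scale by simp
qed

lemma sweedler_counit_right:
  assumes "Vector_Spaces.linear scale t f"
  shows "sweedler t (\<lambda>a b. t (\<epsilon> b) (f a)) x = f x"
proof -
  interpret \<epsilon>: Vector_Spaces.linear scale "(*)" \<epsilon> by (rule counit_linear)
  interpret f: Vector_Spaces.linear scale t f by fact
  have "bilinear_map scale scale (\<lambda>a b. scale (\<epsilon> b) a)"
    by (rule bilinear_mapI) (simp_all add: vector_space_axioms \<epsilon>.add \<epsilon>.scale scale_left_distrib scale_right_distrib mult.commute)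
  then have "x = sweedler scale (\<lambda>a b. scale (\<epsilon> b) a) x"
    using tensor2_lift_comult counit_right by metis
  then have "f x = f (sweedler scale (\<lambda>a b. scale (\<epsilon> b) a) x)" by simp
  then show ?thesis unfolding linear_sweedler[OF assms] f.scale by simp
qed

end

context bialgebra
begin

lemma sweedler_one:
  assumes "bilinear_map scale t \<beta>" shows "sweedler t \<beta> 1 = \<beta> 1 1"
proof -
  have "gen (1, 1) \<in> \<Delta> 1" using comult_one comult_eq_iff_mem by blast
  then show ?thesis
    using bilinear_mapD(1)[OF assms] by (simp add: sweedler_eq[OF assms] module.scale_one module_iff_vector_space)
qed

lemma sweedler_mult:
  assumes \<beta>: "bilinear_map scale t \<beta>"
  shows "sweedler t \<beta> (x * y) = sweedler t (\<lambda>a b. sweedler t (\<lambda>c d. \<beta> (a * c) (b * d)) y) x"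
proof -
  note t = bilinear_mapD(1)[OF \<beta>]
  interpret T: Vector_Spaces.linear free_scale t "free_extend t (\<lambda>(a, b). \<beta> a b)"
    by (rule linear_free_extend[OF t])
  let ?P = "free_extend free_scale (\<lambda>(a, b).
        free_extend free_scale (\<lambda>(c, d). gen (a * c, b * d)) (some_rep y)) (some_rep x)"
  have "?P \<in> tensor2 scale ?P"
    by (rule tensor2_self)
  then have "?P \<in> \<Delta> (x * y)"
    unfolding comult_mult tensor2_mult_def using some_rep_mem by blast
  then show ?thesis
    unfolding sweedler_eq[OF \<beta> \<open>?P \<in> \<Delta> (x * y)\<close>] unfolding sweedler_def
    by (simp add: case_prod_unfold linear_free_extend_compose[OF T.linear_axioms, unfolded case_prod_unfold]
        free_extend_single[OF t] module.scale_one[OF t[folded module_iff_vector_space]])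
qed

lemma convolution_eq_sweedler:
  assumes "Vector_Spaces.linear scale scale f" "Vector_Spaces.linear scale scale g"
  shows "convolution f g x = sweedler scale (\<lambda>a b. f a * g b) x"
proof -
  interpret f: Vector_Spaces.linear scale scale f by fact
  interpret g: Vector_Spaces.linear scale scale g by fact
  show ?thesis unfolding convolution_def
    by (rule tensor2_lift_comult, rule bilinear_mapI)
      (simp_all add: vector_space_axioms f.add f.scale g.add g.scale algebra_simps mult_scale_left mult_scale_right)
qed

end

section \<open>Free vector spaces on finite sets\<close>

lemma gen_eq_iff: "gen x = (gen y :: 'x \<Rightarrow>\<^sub>0 'k::field) \<longleftrightarrow> x = y"
  by (metis Poly_Mapping.lookup_single_eq lookup_single_not_eq zero_neq_one)

lemma independent_gen: "free.independent (gen ` A :: ('x \<Rightarrow>\<^sub>0 'k::field) set)"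
  unfolding free.independent_explicit_module
proof (intro allI impI)
  fix t :: "('x \<Rightarrow>\<^sub>0 'k) set" and u v
  assume t: "finite t" "t \<subseteq> gen ` A" "(\<Sum>v\<in>t. free_scale (u v) v) = 0" "v \<in> t"
  then obtain z where z: "v = gen z" by blast
  have "0 = Poly_Mapping.lookup (\<Sum>v\<in>t. free_scale (u v) v) z" using t(3) by simp
  also have "\<dots> = (\<Sum>w\<in>t. u w * Poly_Mapping.lookup w z)" by (simp add: lookup_sum)
  also have "\<dots> = (\<Sum>w\<in>t. if w = v then u w else 0)"
    by (rule sum.cong[OF refl]) (use t(2) in \<open>auto simp: z lookup_single gen_eq_iff when_def\<close>)
  also have "\<dots> = u v" using t by simp
  finally show "u v = 0" by simp
qed

lemma representation_gen:
  assumes "finite A" "w \<in> free.span (gen ` A)" "z \<in> A"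
  shows "free.representation (gen ` A) w (gen z) = Poly_Mapping.lookup w z"
proof -
  have "Poly_Mapping.lookup w z
      = Poly_Mapping.lookup (\<Sum>v\<in>gen ` A. free_scale (free.representation (gen ` A) w v) v) z"
    using free.sum_representation_eq[OF independent_gen assms(2) _ order_refl] assms(1) by simp
  also have "\<dots> = (\<Sum>v\<in>gen ` A. if v = gen z then free.representation (gen ` A) w v else 0)"
    unfolding lookup_sum
    by (rule sum.cong[OF refl]) (auto simp: lookup_single gen_eq_iff when_def)
  also have "\<dots> = free.representation (gen ` A) w (gen z)" using assms by simp
  finally show ?thesis by simp
qed

lemma trace_wrt_gen:
  fixes f :: "('x \<Rightarrow>\<^sub>0 'k::field) \<Rightarrow> _"
  assumes "finite A" "\<And>z. z \<in> A \<Longrightarrow> f (gen z) \<in> free.span (gen ` A)"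
  shows "trace_wrt free_scale (gen ` A) f = (\<Sum>z\<in>A. Poly_Mapping.lookup (f (gen z)) z)"
proof -
  have inj: "inj_on (gen :: 'x \<Rightarrow> 'x \<Rightarrow>\<^sub>0 'k) A" by (rule inj_onI) (simp add: gen_eq_iff)
  show ?thesis unfolding trace_wrt_def sum.reindex[OF inj]
    by (simp add: representation_gen assms)
qed

section \<open>Gradings and products of elements of positive degree\<close>

context graded_connected_hopf_algebra
begin

lemma subspace_component: "subspace (H m)"
  using grading unfolding graded_by_def by blast

lemma components_independent:
  assumes "finite M" "\<And>m. m \<in> M \<Longrightarrow> f m \<in> H m" "(\<Sum>m\<in>M. f m) = 0" "m \<in> M"
  shows "f m = 0"
proof -
  define P where "P f \<longleftrightarrow> (\<forall>m. f m \<in> H m) \<and> finite {m. f m \<noteq> 0} \<and> 0 = (\<Sum>m\<in>{m. f m \<noteq> 0}. f m)" for f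
  define g where "g m = (if m \<in> M then f m else 0)" for m
  have "{m. g m \<noteq> 0} \<subseteq> M" by (auto simp: g_def)
  then have "(\<Sum>m\<in>{m. g m \<noteq> 0}. g m) = (\<Sum>m\<in>M. g m)"
    by (intro sum.mono_neutral_left assms(1)) auto
  also have "\<dots> = 0" using assms(3) by (simp add: g_def)
  finally have sum: "(\<Sum>m\<in>{m. g m \<noteq> 0}. g m) = 0" .
  have "g m \<in> H m" for m using assms(2) subspace_0[OF subspace_component] by (simp add: g_def)
  moreover have "finite {m. g m \<noteq> 0}"
    using \<open>{m. g m \<noteq> 0} \<subseteq> M\<close> assms(1) by (rule finite_subset)
  ultimately have "P g" using sum unfolding P_def by simp
  moreover have "P (\<lambda>m. 0)" using subspace_0[OF subspace_component] by (simp add: P_def)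
  moreover have "\<exists>!f. P f" using grading unfolding graded_by_def P_def by (elim conjE allE)
  ultimately have "g = (\<lambda>m. 0)" by blast
  then have "g m = 0" by simp
  then show ?thesis using assms(4) by (simp add: g_def)
qed

lemma component_zero: "H 0 = span {1}"
proof -
  have "independent {1}" by simp
  then obtain B where B: "{1} \<subseteq> B" "B \<subseteq> H 0" "independent B" "H 0 \<subseteq> span B"
    using maximal_independent_subset_extend[of "{1}" "H 0"] one_graded by blast
  then have "card B = 1" using basis_card_eq_dim connected by metis
  then have "B = {1}" using B(1) by (auto simp: card_1_singleton_iff)
  then show ?thesis using B span_minimal[OF B(2) subspace_component] by blast
qed

lemma component_zero_eq: "a \<in> H 0 \<Longrightarrow> a = scale (\<epsilon> a) 1"
proof -
  interpret \<epsilon>: Vector_Spaces.linear scale "(*)" \<epsilon> by (rule counit_linear)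
  assume "a \<in> H 0"
  then obtain c where "a = scale c 1" unfolding component_zero span_singleton by blast
  then show ?thesis by (simp add: \<epsilon>.scale counit_one)
qed

lemma sweedler_in_subspace_graded:
  assumes "bilinear_map scale t \<beta>" "module.subspace t U" "x \<in> H m"
    and "\<And>p q a b. p + q = m \<Longrightarrow> a \<in> H p \<Longrightarrow> b \<in> H q \<Longrightarrow> \<beta> a b \<in> U"
  shows "sweedler t \<beta> x \<in> U"
proof -
  obtain P where P: "Poly_Mapping.keys P \<subseteq> (\<Union>(p, q)\<in>{(p, q). p + q = m}. H p \<times> H q)"
      "\<Delta> x = tensor2 scale P"
    using comult_graded[OF assms(3)] by blast
  then have "P \<in> \<Delta> x" using comult_eq_iff_mem by blast
  then show ?thesis
    by (rule sweedler_in_subspace[OF assms(1,2)]) (use P(1) assms(4) in blast)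
qed

text \<open>
  The terms of \<open>\<Delta> x\<close> whose left factor has degree \<open>0\<close> add up to \<open>1 \<otimes> x\<close>: since \<open>H 0\<close> consists of the
  multiples of \<open>1\<close>, they are \<open>\<Sum> \<epsilon>(x\<^sub>1) 1 \<otimes> x\<^sub>2\<close>, and the counit axiom applies. So up to \<open>\<beta> 1 x\<close> only
  the terms with a left factor of positive degree matter. This is where connectedness enters.
\<close>

lemma sweedler_minus_left_unit_term:
  assumes \<beta>: "bilinear_map scale t \<beta>" and U: "module.subspace t U" and x: "x \<in> H m"
    and pos: "\<And>p q a b. p > 0 \<Longrightarrow> p + q = m \<Longrightarrow> a \<in> H p \<Longrightarrow> b \<in> H q \<Longrightarrow> \<beta> a b \<in> U"
  shows "sweedler t \<beta> x - \<beta> 1 x \<in> U"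
proof -
  note t = bilinear_mapD(1)[OF \<beta>]
  interpret t: vector_space t by (rule t)
  interpret \<epsilon>: Vector_Spaces.linear scale "(*)" \<epsilon> by (rule counit_linear)
  have "bilinear_map scale t (\<lambda>a b. \<beta> a b - t (\<epsilon> a) (\<beta> 1 b))"
    by (rule bilinear_mapI[OF t])
      (simp_all add: bilinear_mapD[OF \<beta>] \<epsilon>.add \<epsilon>.scale t.scale_left_distrib t.scale_right_distrib
        t.scale_right_diff_distrib mult.commute)
  then have "sweedler t (\<lambda>a b. \<beta> a b - t (\<epsilon> a) (\<beta> 1 b)) x \<in> U"
  proof (rule sweedler_in_subspace_graded[OF _ U x])
    fix p q a b assume *: "p + q = m" "a \<in> H p" "b \<in> H q"
    show "\<beta> a b - t (\<epsilon> a) (\<beta> 1 b) \<in> U"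
    proof (cases "p = 0")
      case True
      then have "\<beta> a b = t (\<epsilon> a) (\<beta> 1 b)"
        using component_zero_eq[of a] *(2) bilinear_mapD(3)[OF \<beta>] by metis
      then show ?thesis using t.subspace_0[OF U] by simp
    next
      case False
      then show ?thesis using pos[OF _ *] counit_graded[OF _ *(2)] by simp
    qed
  qed
  moreover have "sweedler t (\<lambda>a b. \<beta> a b - t (\<epsilon> a) (\<beta> 1 b)) x + sweedler t (\<lambda>a b. t (\<epsilon> a) (\<beta> 1 b)) x = sweedler t \<beta> x"
    unfolding sweedler_plus[OF t, symmetric] by simp
  moreover have "sweedler t (\<lambda>a b. t (\<epsilon> a) (\<beta> 1 b)) x = \<beta> 1 x"
    by (rule sweedler_counit_left[OF bilinear_mapD(6)[OF \<beta>]])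
  ultimately show ?thesis by (simp add: eq_diff_eq[symmetric])
qed

text \<open>
  \<open>positive_product n p x\<close>: \<open>x\<close> is a product of \<open>n\<close> homogeneous factors of positive degree, of total
  degree \<open>p\<close>. Products of at least \<open>n\<close> such factors span the \<open>n\<close>-th power of the augmentation
  ideal.
\<close>

inductive positive_product :: "nat \<Rightarrow> nat \<Rightarrow> 'h \<Rightarrow> bool" where
  empty: "positive_product 0 0 1"
| snoc: "positive_product n p x \<Longrightarrow> q > 0 \<Longrightarrow> y \<in> H q \<Longrightarrow> positive_product (Suc n) (p + q) (x * y)"

lemma positive_product_degree: "positive_product n p x \<Longrightarrow> x \<in> H p"
  by (induction rule: positive_product.induct) (auto intro: one_graded mult_graded)

lemma positive_product_length: "positive_product n p x \<Longrightarrow> n \<le> p"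
  by (induction rule: positive_product.induct) auto

lemma positive_product_single: "q > 0 \<Longrightarrow> y \<in> H q \<Longrightarrow> positive_product 1 q y"
  using snoc[OF empty, of q y] by simp

lemma positive_product_mult:
  assumes "positive_product n p x" "positive_product k q y"
  shows "positive_product (n + k) (p + q) (x * y)"
  using assms(2,1)
proof (induction rule: positive_product.induct)
  case (snoc k q y r z)
  then have "positive_product (Suc (n + k)) ((p + q) + r) ((x * y) * z)"
    by (intro positive_product.snoc)
  then show ?case by (simp add: algebra_simps)
qed simp

lemma homogeneous_multiple_of_positive_product:
  assumes "a \<in> H p"
  obtains c x where "positive_product (if p = 0 then 0 else 1) p x" "a = scale c x"
proof (cases "p = 0")
  case True
  then show ?thesis using that[of 1 "\<epsilon> a"] component_zero_eq assms empty by simp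
next
  case False
  then show ?thesis using that[of a 1] positive_product_single[of p a] assms by simp
qed

end

section \<open>Coordinates on the tensor square\<close>

text \<open>
  Bases of the components and an antipode are fixed here, so that the coordinate model of
  \<open>H \<otimes> H\<close> can depend on the bases.
\<close>

locale graded_hopf_algebra_with_basis = graded_connected_hopf_algebra scale \<Delta> \<epsilon> H
  for scale :: "'k::field \<Rightarrow> 'h::ring_1 \<Rightarrow> 'h"
    and \<Delta> :: "'h \<Rightarrow> ('h \<times> 'h \<Rightarrow>\<^sub>0 'k) set"
    and \<epsilon> :: "'h \<Rightarrow> 'k"
    and H :: "nat \<Rightarrow> 'h set" +
  fixes basis :: "nat \<Rightarrow> 'h set" and S :: "'h \<Rightarrow> 'h"
  assumes finite_basis: "finite (basis m)"
    and independent_basis: "independent (basis m)"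
    and span_basis: "span (basis m) = H m"
    and antipode: "is_antipode S"
begin

sublocale S: Vector_Spaces.linear scale scale S
  using antipode unfolding is_antipode_def by blast

lemma sweedler_antipode_left: "sweedler scale (\<lambda>a b. S a * b) x = scale (\<epsilon> x) 1"
  using antipode convolution_eq_sweedler[OF S.linear_axioms linear_id] by (simp add: is_antipode_def)

lemma sweedler_antipode_right: "sweedler scale (\<lambda>a b. a * S b) x = scale (\<epsilon> x) 1"
  using antipode convolution_eq_sweedler[OF linear_id S.linear_axioms] by (simp add: is_antipode_def)

text \<open>
  Up to terms \<open>x\<^sub>1 S(x\<^sub>2)\<close> with \<open>x\<^sub>2\<close> of smaller degree, the axiom \<open>\<Sum> x\<^sub>1 S(x\<^sub>2) = \<epsilon>(x) 1\<close> expresses \<open>S x\<close> through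
  an element of \<open>H m\<close>, so strong induction applies.
\<close>

lemma antipode_graded: "x \<in> H m \<Longrightarrow> S x \<in> H m"
proof (induction m arbitrary: x rule: less_induct)
  case (less m)
  have bil: "bilinear_map scale scale (\<lambda>a b. a * S b)"
    by (rule bilinear_mapI)
      (simp_all add: vector_space_axioms S.add S.scale algebra_simps mult_scale_left mult_scale_right)
  have "sweedler scale (\<lambda>a b. a * S b) x - 1 * S x \<in> H m"
    by (rule sweedler_minus_left_unit_term[OF bil subspace_component less.prems])
      (use less.IH mult_graded in fastforce)
  moreover have "scale (\<epsilon> x) 1 \<in> H m"
    using counit_graded[OF _ less.prems] one_graded subspace_0[OF subspace_component]
      subspace_scale[OF subspace_component] by (cases "m = 0") auto
  ultimately have "scale (\<epsilon> x) 1 - (scale (\<epsilon> x) 1 - 1 * S x) \<in> H m"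
    unfolding sweedler_antipode_right using subspace_diff[OF subspace_component] by blast
  then show ?case by simp
qed

definition full_basis :: "'h set" where "full_basis = (\<Union>m. basis m)"

lemma basis_subset: "basis m \<subseteq> H m"
  using span_basis[of m] span_base by blast

lemma basis_disjoint: "m \<noteq> n \<Longrightarrow> basis m \<inter> basis n = {}"
proof (rule ccontr)
  assume mn: "m \<noteq> n" and "basis m \<inter> basis n \<noteq> {}"
  then obtain v where v: "v \<in> basis m" "v \<in> basis n" by blast
  have "(if m = m then v else - v) = 0"
    by (rule components_independent[of "{m, n}" "\<lambda>k. if k = m then v else - v"])
      (use mn v basis_subset subspace_neg[OF subspace_component] in \<open>auto simp: subset_iff\<close>)
  then show False using v(1) independent_basis dependent_zero by auto
qed

lemma independent_full_basis: "independent full_basis"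
  unfolding independent_explicit_module
proof (intro allI impI)
  fix t u v
  assume t: "finite t" "t \<subseteq> full_basis" "(\<Sum>v\<in>t. scale (u v) v) = 0" "v \<in> t"
  obtain d where d: "\<And>v. v \<in> t \<Longrightarrow> v \<in> basis (d v)" using t(2) unfolding full_basis_def by (metis UN_E subsetD)
  have part: "{v \<in> t. d v = m} \<subseteq> basis m" for m using d by blast
  have "(\<Sum>m\<in>d ` t. \<Sum>v\<in>{v \<in> t. d v = m}. scale (u v) v) = 0"
    using sum.image_gen[OF t(1), of "\<lambda>v. scale (u v) v" d] t(3) by simp
  then have "(\<Sum>v\<in>{v \<in> t. d v = m}. scale (u v) v) = 0" if "m \<in> d ` t" for m
  proof (rule components_independent[rotated 2])
    show "(\<Sum>v\<in>{v \<in> t. d v = m}. scale (u v) v) \<in> H m" for m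
      using part basis_subset by (intro subspace_sum subspace_scale subspace_component) blast
  qed (use t(1) that in auto)
  then have "(\<Sum>w\<in>{w \<in> t. d w = d v}. scale (u w) w) = 0" using t(4) by blast
  then show "u v = 0"
    using independentD[OF independent_basis _ part, of "d v" u v] t(1,4) by auto
qed

lemma span_full_basis: "span full_basis = UNIV"
proof -
  have "x \<in> span full_basis" for x
  proof -
    obtain f where f: "\<forall>m. f m \<in> H m" "x = (\<Sum>m\<in>{m. f m \<noteq> 0}. f m)"
      using grading unfolding graded_by_def by blast
    have "f m \<in> span full_basis" for m
      using f(1) span_basis[of m] span_mono[of "basis m" full_basis] by (auto simp: full_basis_def)
    then show ?thesis unfolding f(2) by (rule span_sum)
  qed
  then show ?thesis by blast
qed

abbreviation coord :: "'h \<Rightarrow> 'h \<Rightarrow> 'k" where "coord \<equiv> representation full_basis"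

lemma coord_add: "coord (x + y) b = coord x b + coord y b"
  using representation_add[OF independent_full_basis] span_full_basis by simp

lemma coord_scale: "coord (scale c x) b = c * coord x b"
  using representation_scale[OF independent_full_basis] span_full_basis by simp

lemma coord_component:
  assumes "x \<in> H m" shows "coord x = representation (basis m) x"
  by (rule representation_extend[OF independent_full_basis])
    (use assms span_basis in \<open>auto simp: full_basis_def\<close>)

text \<open>
  The element \<open>a \<otimes> b\<close>. Only finitely supported functions on pairs of basis vectors are used as
  elements of \<open>H \<otimes> H\<close>, although the type allows arbitrary pairs.
\<close>

definition tens :: "'h \<Rightarrow> 'h \<Rightarrow> ('h \<times> 'h \<Rightarrow>\<^sub>0 'k)" where
  "tens a b = Abs_poly_mapping (\<lambda>(x, y). coord a x * coord b y)"

lemma lookup_tens: "Poly_Mapping.lookup (tens a b) (x, y) = coord a x * coord b y"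
proof -
  have "finite ({x. coord a x \<noteq> 0} \<times> {y. coord b y \<noteq> 0})"
    using finite_representation by blast
  moreover have "{p. (case p of (x, y) \<Rightarrow> coord a x * coord b y) \<noteq> 0}
      \<subseteq> {x. coord a x \<noteq> 0} \<times> {y. coord b y \<noteq> 0}" by auto
  ultimately show ?thesis unfolding tens_def by (subst lookup_Abs_poly_mapping) (auto intro: finite_subset)
qed

lemma tens_basis: "x \<in> full_basis \<Longrightarrow> y \<in> full_basis \<Longrightarrow> tens x y = gen (x, y)"
  by (rule poly_mapping_eqI)
    (auto simp: lookup_tens representation_basis[OF independent_full_basis] lookup_single when_def
      split: if_splits)

lemma tens_linear:
  "tens (a + a') b = tens a b + tens a' b" "tens (scale c a) b = free_scale c (tens a b)"
  "tens a (b + b') = tens a b + tens a b'" "tens a (scale c b) = free_scale c (tens a b)"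
  by (rule poly_mapping_eqI; auto simp: lookup_tens lookup_add coord_add coord_scale algebra_simps)+

lemma bilinear_tens: "bilinear_map scale free_scale tens"
  by (rule bilinear_mapI[OF free.vector_space_axioms]) (rule tens_linear)+

text \<open>
  The universal property of the coordinate model. Both sides are bilinear in \<open>a\<close> and \<open>b\<close>, so
  basis vectors suffice.
\<close>

lemma free_extend_tens:
  assumes \<beta>: "bilinear_map scale t \<beta>"
  shows "free_extend t (\<lambda>(a, b). \<beta> a b) (tens a b) = \<beta> a b"
proof -
  note t = bilinear_mapD(1)[OF \<beta>]
  interpret t: vector_space t by (rule t)
  interpret pair: vector_space_pair scale t ..
  let ?f = "free_extend t (\<lambda>(a, b). \<beta> a b)"
  have left: "Vector_Spaces.linear scale t (\<lambda>a. ?f (tens a b))" for b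
    using Vector_Spaces.linear_compose[OF bilinear_mapD(7)[OF bilinear_tens] linear_free_extend[OF t]]
    unfolding o_def .
  have right: "Vector_Spaces.linear scale t (\<lambda>b. ?f (tens a b))" for a
    using Vector_Spaces.linear_compose[OF bilinear_mapD(6)[OF bilinear_tens] linear_free_extend[OF t]]
    unfolding o_def .
  have basis: "?f (tens x y) = \<beta> x y" if "x \<in> full_basis" "y \<in> full_basis" for x y
    by (simp add: tens_basis that free_extend_single[OF t])
  have "?f (tens x b) = \<beta> x b" if "x \<in> full_basis" for x
    by (rule pair.linear_eq_on[OF right bilinear_mapD(6)[OF \<beta>], of b full_basis])
      (use span_full_basis basis that in auto)
  then show ?thesis
    by (intro pair.linear_eq_on[OF left bilinear_mapD(7)[OF \<beta>], of a full_basis])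
      (use span_full_basis in auto)
qed

abbreviation tens_lift :: "('h \<Rightarrow> 'h \<Rightarrow> ('h \<times> 'h \<Rightarrow>\<^sub>0 'k)) \<Rightarrow> ('h \<times> 'h \<Rightarrow>\<^sub>0 'k) \<Rightarrow> ('h \<times> 'h \<Rightarrow>\<^sub>0 'k)" where
  "tens_lift \<beta> \<equiv> free_extend free_scale (\<lambda>(a, b). \<beta> a b)"

lemma linear_tens_lift: "Vector_Spaces.linear free_scale free_scale (tens_lift \<beta>)"
  by (rule linear_free_extend[OF free.vector_space_axioms])

definition tens_mult :: "('h \<times> 'h \<Rightarrow>\<^sub>0 'k) \<Rightarrow> ('h \<times> 'h \<Rightarrow>\<^sub>0 'k) \<Rightarrow> ('h \<times> 'h \<Rightarrow>\<^sub>0 'k)" where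
  "tens_mult v w = tens_lift (\<lambda>a b. tens_lift (\<lambda>c d. tens (a * c) (b * d)) w) v"

lemma linear_tens_mult_left: "Vector_Spaces.linear free_scale free_scale (\<lambda>v. tens_mult v w)"
  unfolding tens_mult_def by (rule linear_tens_lift)

lemma linear_tens_mult_right: "Vector_Spaces.linear free_scale free_scale (tens_mult v)"
proof -
  have "tens_mult v = tens_lift (\<lambda>c d. tens_lift (\<lambda>a b. tens (a * c) (b * d)) v)"
    unfolding tens_mult_def case_prod_unfold
    by (rule ext, rule free_extend_swap[OF free.vector_space_axioms])
  then show ?thesis using linear_tens_lift by simp
qed

lemmas tens_algebra = tens_linear mult_scale_left mult_scale_right distrib_left distrib_right
  S.add S.scale

lemma tens_mult_tens: "tens_mult (tens a b) (tens c d) = tens (a * c) (b * d)"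
proof -
  have 1: "bilinear_map scale free_scale (\<lambda>c d. tens (a * c) (b * d))" for a b
    by (rule bilinear_mapI[OF free.vector_space_axioms]) (simp_all add: tens_algebra)
  have 2: "bilinear_map scale free_scale (\<lambda>a b. tens (a * c) (b * d))"
    by (rule bilinear_mapI[OF free.vector_space_axioms]) (simp_all add: tens_algebra)
  show ?thesis unfolding tens_mult_def free_extend_tens[OF 1] by (rule free_extend_tens[OF 2])
qed

text \<open>
  The coproduct with values in the coordinate model.
\<close>

definition coord_comult :: "'h \<Rightarrow> ('h \<times> 'h \<Rightarrow>\<^sub>0 'k)" where
  "coord_comult = sweedler free_scale tens"

lemma linear_coord_comult: "Vector_Spaces.linear scale free_scale coord_comult"
  unfolding coord_comult_def by (rule sweedler_arg_linear[OF bilinear_tens])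

lemma coord_comult_one: "coord_comult 1 = tens 1 1"
  unfolding coord_comult_def by (rule sweedler_one[OF bilinear_tens])

lemma coord_comult_mult: "coord_comult (x * y) = tens_mult (coord_comult x) (coord_comult y)"
  unfolding coord_comult_def sweedler_mult[OF bilinear_tens]
  by (simp add: linear_sweedler[OF linear_tens_mult_left] linear_sweedler[OF linear_tens_mult_right]
      tens_mult_tens) (rule sweedler_swap[OF free.vector_space_axioms])

definition swap :: "('h \<times> 'h \<Rightarrow>\<^sub>0 'k) \<Rightarrow> ('h \<times> 'h \<Rightarrow>\<^sub>0 'k)" where
  "swap = tens_lift (\<lambda>a b. tens b a)"

lemma linear_swap: "Vector_Spaces.linear free_scale free_scale swap"
  unfolding swap_def by (rule linear_tens_lift)

lemma swap_tens: "swap (tens a b) = tens b a"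
  unfolding swap_def
  by (rule free_extend_tens, rule bilinear_mapI[OF free.vector_space_axioms]) (simp_all add: tens_algebra)

section \<open>Two filtrations of the tensor square\<close>

text \<open>
  Both filtrations live on the component of degree \<open>m\<close> of \<open>H \<otimes> H\<close>, which is \<open>degree_filt 0 m\<close>; \<open>n\<close> is
  the level. The first is by the degree of the left factor, the second by the total number of
  factors of positive degree.
\<close>

definition degree_filt :: "nat \<Rightarrow> nat \<Rightarrow> ('h \<times> 'h \<Rightarrow>\<^sub>0 'k) set" where
  "degree_filt n m = free.span {tens a b | a b p q. n \<le> p \<and> p + q = m \<and> a \<in> H p \<and> b \<in> H q}"

definition length_filt :: "nat \<Rightarrow> nat \<Rightarrow> ('h \<times> 'h \<Rightarrow>\<^sub>0 'k) set" where
  "length_filt n m = free.span {tens x y | x y i j p q.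
     positive_product i p x \<and> positive_product j q y \<and> n \<le> i + j \<and> p + q = m}"

lemma subspace_degree_filt [simp]: "free.subspace (degree_filt n m)" unfolding degree_filt_def by simp
lemma subspace_length_filt [simp]: "free.subspace (length_filt n m)" unfolding length_filt_def by simp

lemma degree_filt_tens: "a \<in> H p \<Longrightarrow> b \<in> H q \<Longrightarrow> n \<le> p \<Longrightarrow> p + q = m \<Longrightarrow> tens a b \<in> degree_filt n m"
  unfolding degree_filt_def by (rule free.span_base) blast

lemma length_filt_tens: "positive_product i p x \<Longrightarrow> positive_product j q y \<Longrightarrow> n \<le> i + j \<Longrightarrow> p + q = m
    \<Longrightarrow> tens x y \<in> length_filt n m"
  unfolding length_filt_def by (rule free.span_base) blast

lemma degree_filt_induct [consumes 3, case_names tens]: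
  assumes "w \<in> degree_filt n m" "Vector_Spaces.linear free_scale free_scale f" "free.subspace U"
    and "\<And>a b p q. n \<le> p \<Longrightarrow> p + q = m \<Longrightarrow> a \<in> H p \<Longrightarrow> b \<in> H q \<Longrightarrow> f (tens a b) \<in> U"
  shows "f w \<in> U"
  by (rule linear_span_in_subspace[OF assms(2) assms(1)[unfolded degree_filt_def] assms(3)])
    (use assms(4) in auto)

lemma length_filt_induct [consumes 3, case_names tens]:
  assumes "w \<in> length_filt n m" "Vector_Spaces.linear free_scale free_scale f" "free.subspace U"
    and "\<And>x y i j p q. positive_product i p x \<Longrightarrow> positive_product j q y \<Longrightarrow> n \<le> i + j \<Longrightarrow> p + q = m
      \<Longrightarrow> f (tens x y) \<in> U"
  shows "f w \<in> U"
  by (rule linear_span_in_subspace[OF assms(2) assms(1)[unfolded length_filt_def] assms(3)])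
    (use assms(4) in auto)

lemma degree_filt_mono: "n \<le> k \<Longrightarrow> degree_filt k m \<subseteq> degree_filt n m"
  unfolding degree_filt_def by (rule free.span_mono) (use order_trans in blast)

lemma length_filt_mono: "n \<le> k \<Longrightarrow> length_filt k m \<subseteq> length_filt n m"
  unfolding length_filt_def by (rule free.span_mono) (use order_trans in blast)

lemma degree_filt_bounded: "degree_filt (Suc m) m = {0}"
proof -
  have "{tens a b | a b p q. Suc m \<le> p \<and> p + q = m \<and> a \<in> H p \<and> b \<in> H q} = {}" by auto
  then show ?thesis unfolding degree_filt_def by (simp only: free.span_empty)
qed

lemma length_filt_bounded: "length_filt (Suc m) m = {0}"
proof -
  have "{tens x y | x y i j p q. positive_product i p x \<and> positive_product j q y
      \<and> Suc m \<le> i + j \<and> p + q = m} = {}"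
    by (auto dest!: positive_product_length)
  then show ?thesis unfolding length_filt_def by (simp only: free.span_empty)
qed

text \<open>
  An element of positive degree is a product with one factor, and an element of degree \<open>0\<close> is a
  multiple of the empty product.
\<close>

lemma homogeneous_tens_in_length_filt:
  assumes "a \<in> H p" "b \<in> H q" "p + q = m"
    and "n \<le> (if p = 0 then 0 else 1) + (if q = 0 then 0 else 1)"
  shows "tens a b \<in> length_filt n m"
proof -
  obtain c x where x: "positive_product (if p = 0 then 0 else 1) p x" "a = scale c x"
    using homogeneous_multiple_of_positive_product[OF assms(1)] .
  obtain d y where y: "positive_product (if q = 0 then 0 else 1) q y" "b = scale d y"
    using homogeneous_multiple_of_positive_product[OF assms(2)] .
  have "tens x y \<in> length_filt n m" by (rule length_filt_tens[OF x(1) y(1) assms(4,3)])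
  then show ?thesis by (simp add: x(2) y(2) tens_linear free.subspace_scale)
qed

lemma length_filt_0: "length_filt 0 m = degree_filt 0 m"
proof
  show "length_filt 0 m \<subseteq> degree_filt 0 m"
    unfolding length_filt_def
    by (rule free.span_minimal) (auto intro!: degree_filt_tens positive_product_degree)
  show "degree_filt 0 m \<subseteq> length_filt 0 m"
    unfolding degree_filt_def
    by (rule free.span_minimal) (auto intro: homogeneous_tens_in_length_filt)
qed

lemma tens_mult_length_filt:
  assumes "v \<in> length_filt n m" "w \<in> length_filt k l"
  shows "tens_mult v w \<in> length_filt (n + k) (m + l)"
  using assms(1) linear_tens_mult_left subspace_length_filt
proof (rule length_filt_induct)
  fix x y i j p q
  assume xy: "positive_product i p x" "positive_product j q y" "n \<le> i + j" "p + q = m"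
  show "tens_mult (tens x y) w \<in> length_filt (n + k) (m + l)"
    using assms(2) linear_tens_mult_right subspace_length_filt
  proof (rule length_filt_induct)
    fix x' y' i' j' p' q'
    assume xy': "positive_product i' p' x'" "positive_product j' q' y'" "k \<le> i' + j'" "p' + q' = l"
    show "tens_mult (tens x y) (tens x' y') \<in> length_filt (n + k) (m + l)"
      unfolding tens_mult_tens
      by (rule length_filt_tens[OF positive_product_mult[OF xy(1) xy'(1)] positive_product_mult[OF xy(2) xy'(2)]])
        (use xy xy' in auto)
  qed
qed

lemma swap_length_filt:
  assumes "w \<in> length_filt n m" shows "swap w \<in> length_filt n m"
  using assms linear_swap subspace_length_filt
proof (rule length_filt_induct)
  fix x y i j p q
  assume "positive_product i p x" "positive_product j q y" "n \<le> i + j" "p + q = m"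
  then show "swap (tens x y) \<in> length_filt n m"
    unfolding swap_tens by (auto intro!: length_filt_tens[of j q y i p x])
qed

lemma coord_comult_length_filt_1:
  assumes "y \<in> H q" "q > 0" shows "coord_comult y \<in> length_filt 1 q"
  unfolding coord_comult_def
  by (rule sweedler_in_subspace_graded[OF bilinear_tens subspace_length_filt assms(1)])
    (use assms(2) in \<open>auto intro!: homogeneous_tens_in_length_filt\<close>)

text \<open>
  The term \<open>1 \<otimes> y\<close> is split off by \<open>sweedler_minus_left_unit_term\<close>, and the term \<open>y \<otimes> 1\<close> in the same way by
  subtracting \<open>\<epsilon>(y\<^sub>2) (y\<^sub>1 \<otimes> 1)\<close>. What remains has two factors of positive degree.
\<close>

lemma coord_comult_primitive_part:
  assumes "y \<in> H q" "q > 0" shows "coord_comult y - tens y 1 - tens 1 y \<in> length_filt 2 q"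
proof -
  interpret \<epsilon>: Vector_Spaces.linear scale "(*)" \<epsilon> by (rule counit_linear)
  interpret c: Vector_Spaces.linear scale free_scale "\<lambda>a. tens a 1"
    by (rule bilinear_mapD(7)[OF bilinear_tens])
  have bil: "bilinear_map scale free_scale (\<lambda>a b. tens a b - free_scale (\<epsilon> b) (tens a 1))"
    by (rule bilinear_mapI[OF free.vector_space_axioms])
      (simp_all add: tens_linear \<epsilon>.add \<epsilon>.scale free.scale_left_distrib free.scale_right_distrib
        free.scale_right_diff_distrib mult.commute)
  have "sweedler free_scale (\<lambda>a b. tens a b - free_scale (\<epsilon> b) (tens a 1)) y
      - (tens 1 y - free_scale (\<epsilon> y) (tens 1 1)) \<in> length_filt 2 q"
  proof (rule sweedler_minus_left_unit_term[OF bil subspace_length_filt assms(1)])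
    fix p q' a b assume *: "0 < p" "p + q' = q" "a \<in> H p" "b \<in> H q'"
    show "tens a b - free_scale (\<epsilon> b) (tens a 1) \<in> length_filt 2 q"
    proof (cases "q' = 0")
      case True
      then have "tens a b = free_scale (\<epsilon> b) (tens a 1)"
        using component_zero_eq[of b] *(4) tens_linear(4) by metis
      then show ?thesis using free.subspace_0[OF subspace_length_filt] by simp
    next
      case False
      then show ?thesis using * counit_graded[OF _ *(4)] by (auto intro!: homogeneous_tens_in_length_filt)
    qed
  qed
  moreover have "sweedler free_scale (\<lambda>a b. tens a b - free_scale (\<epsilon> b) (tens a 1)) y
      + sweedler free_scale (\<lambda>a b. free_scale (\<epsilon> b) (tens a 1)) y = coord_comult y"
    unfolding sweedler_plus[OF free.vector_space_axioms, symmetric] coord_comult_def by simp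
  moreover have "sweedler free_scale (\<lambda>a b. free_scale (\<epsilon> b) (tens a 1)) y = tens y 1"
    by (rule sweedler_counit_right[OF c.linear_axioms])
  moreover have "\<epsilon> y = 0" using counit_graded assms by blast
  ultimately show ?thesis by (simp add: eq_diff_eq[symmetric])
qed

text \<open>
  The coproduct is multiplicative, and each factor of positive degree contributes one to the level.
\<close>

lemma coord_comult_length_filt: "positive_product n p x \<Longrightarrow> coord_comult x \<in> length_filt n p"
proof (induction rule: positive_product.induct)
  case empty
  show ?case unfolding coord_comult_one by (rule length_filt_tens[OF positive_product.empty positive_product.empty]) auto
next
  case (snoc n p x q y)
  then show ?case unfolding coord_comult_mult
    using tens_mult_length_filt[OF snoc.IH coord_comult_length_filt_1[OF snoc.hyps(3,2)]] by simp
qed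

lemma swap_tens_mult_coord_comult: "swap (tens_mult (coord_comult x) (coord_comult y)) = tens_mult (swap (coord_comult x)) (swap (coord_comult y))"
  unfolding coord_comult_def
  by (simp add: linear_sweedler[OF linear_tens_mult_left] linear_sweedler[OF linear_tens_mult_right]
      linear_sweedler[OF linear_swap] tens_mult_tens swap_tens)

text \<open>
  Induction on the number of factors. For a single factor \<open>y\<close>, the symmetric part \<open>y \<otimes> 1 + 1 \<otimes> y\<close>
  cancels and the rest has level two. For a product,
  \<open>\<Delta>(x y) - \<tau> \<Delta>(x y) = (\<Delta> x - \<tau> \<Delta> x) \<Delta> y + \<tau> \<Delta> x (\<Delta> y - \<tau> \<Delta> y)\<close>, and both summands gain a level.
\<close>

lemma coord_comult_cocommutative_mod_length_filt:
  "positive_product n p x \<Longrightarrow> coord_comult x - swap (coord_comult x) \<in> length_filt (Suc n) p"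
proof (induction rule: positive_product.induct)
  case empty
  show ?case by (simp add: coord_comult_one swap_tens free.subspace_0)
next
  case (snoc n p x q y)
  interpret sw: Vector_Spaces.linear free_scale free_scale swap by (rule linear_swap)
  have y: "coord_comult y - swap (coord_comult y) \<in> length_filt 2 q"
  proof -
    let ?r = "coord_comult y - tens y 1 - tens 1 y"
    have r: "?r \<in> length_filt 2 q" by (rule coord_comult_primitive_part[OF snoc.hyps(3,2)])
    have "?r - swap ?r \<in> length_filt 2 q" by (rule free.subspace_diff[OF subspace_length_filt r swap_length_filt[OF r]])
    moreover have "?r - swap ?r = coord_comult y - swap (coord_comult y)" by (simp add: sw.diff swap_tens)
    ultimately show ?thesis by simp
  qed
  have "tens_mult (coord_comult x - swap (coord_comult x)) (coord_comult y)
      + tens_mult (swap (coord_comult x)) (coord_comult y - swap (coord_comult y)) \<in> length_filt (Suc (Suc n)) (p + q)"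
    using tens_mult_length_filt[OF snoc.IH coord_comult_length_filt_1[OF snoc.hyps(3,2)]]
      tens_mult_length_filt[OF swap_length_filt[OF coord_comult_length_filt[OF snoc.hyps(1)]] y]
    by (intro free.subspace_add subspace_length_filt) simp_all
  moreover have "tens_mult (coord_comult x - swap (coord_comult x)) (coord_comult y)
      + tens_mult (swap (coord_comult x)) (coord_comult y - swap (coord_comult y))
      = coord_comult (x * y) - swap (coord_comult (x * y))"
    unfolding coord_comult_mult swap_tens_mult_coord_comult
    by (simp add: module_hom.diff[OF linear_tens_mult_left[unfolded linear_iff_module_hom]]
        module_hom.diff[OF linear_tens_mult_right[unfolded linear_iff_module_hom]])
  ultimately show ?case by simp
qed

section \<open>The Galois map\<close>

lemma bilinear_tens_mult:
  assumes f: "Vector_Spaces.linear scale free_scale f" and g: "Vector_Spaces.linear scale free_scale g"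
  shows "bilinear_map scale free_scale (\<lambda>a b. tens_mult (f a) (g b))"
  unfolding bilinear_map_def
  using Vector_Spaces.linear_compose[OF f linear_tens_mult_left]
    Vector_Spaces.linear_compose[OF g linear_tens_mult_right]
  by (simp add: o_def)

lemma linear_tens_left: "Vector_Spaces.linear scale free_scale (\<lambda>a. tens a b)"
  and linear_tens_right: "Vector_Spaces.linear scale free_scale (tens a)"
  using bilinear_mapD(6,7)[OF bilinear_tens] by auto

definition comult_antipode :: "'h \<Rightarrow> ('h \<times> 'h \<Rightarrow>\<^sub>0 'k)" where
  "comult_antipode = sweedler free_scale (\<lambda>x y. tens x (S y))"

lemma bilinear_tens_antipode: "bilinear_map scale free_scale (\<lambda>x y. tens x (S y))"
  by (rule bilinear_mapI[OF free.vector_space_axioms]) (simp_all add: tens_algebra)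

lemma linear_comult_antipode: "Vector_Spaces.linear scale free_scale comult_antipode"
  unfolding comult_antipode_def by (rule sweedler_arg_linear[OF bilinear_tens_antipode])

text \<open>
  In Sweedler's notation the four operators are \<open>a\<^sub>1 \<otimes> a\<^sub>2 b\<close>, \<open>a\<^sub>1 \<otimes> S(a\<^sub>2) b\<close>, \<open>a\<^sub>1 b \<otimes> a\<^sub>2\<close> and \<open>a b\<^sub>1 \<otimes> S(b\<^sub>2)\<close>;
  they are called \<open>\<beta>\<close>, \<open>\<gamma>\<close>, \<open>X\<close> and \<open>U\<close> in the introduction.
\<close>

definition galois where "galois = tens_lift (\<lambda>a b. tens_mult (coord_comult a) (tens 1 b))"
definition galois_inv where "galois_inv = tens_lift (\<lambda>a b. tens_mult (comult_antipode a) (tens 1 b))"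
definition comult_left where "comult_left = tens_lift (\<lambda>a b. tens_mult (coord_comult a) (tens b 1))"
definition antipode_twist where "antipode_twist = tens_lift (\<lambda>a b. tens_mult (tens a 1) (comult_antipode b))"

lemma galois_tens: "galois (tens a b) = tens_mult (coord_comult a) (tens 1 b)"
  unfolding galois_def by (rule free_extend_tens[OF bilinear_tens_mult[OF linear_coord_comult linear_tens_right]])

lemma galois_inv_tens: "galois_inv (tens a b) = tens_mult (comult_antipode a) (tens 1 b)"
  unfolding galois_inv_def
  by (rule free_extend_tens[OF bilinear_tens_mult[OF linear_comult_antipode linear_tens_right]])

lemma comult_left_tens: "comult_left (tens a b) = tens_mult (coord_comult a) (tens b 1)"
  unfolding comult_left_def by (rule free_extend_tens[OF bilinear_tens_mult[OF linear_coord_comult linear_tens_left]])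

lemma antipode_twist_tens: "antipode_twist (tens a b) = tens_mult (tens a 1) (comult_antipode b)"
  unfolding antipode_twist_def
  by (rule free_extend_tens[OF bilinear_tens_mult[OF linear_tens_left linear_comult_antipode]])

lemma linear_ops:
  "Vector_Spaces.linear free_scale free_scale galois"
  "Vector_Spaces.linear free_scale free_scale galois_inv"
  "Vector_Spaces.linear free_scale free_scale comult_left"
  "Vector_Spaces.linear free_scale free_scale antipode_twist"
  unfolding galois_def galois_inv_def comult_left_def antipode_twist_def by (rule linear_tens_lift)+

lemma linear_mult_right_const:
  "Vector_Spaces.linear scale scale (\<lambda>a. a * b)"
  unfolding Vector_Spaces.linear_iff by (simp add: vector_space_axioms distrib_right mult_scale_left)

text \<open>
  \<open>a\<^sub>1 \<otimes> S(a\<^sub>2) a\<^sub>3 b = a\<^sub>1 \<otimes> \<epsilon>(a\<^sub>2) b = a \<otimes> b\<close>.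
\<close>

lemma galois_inv_galois_tens: "galois_inv (galois (tens a b)) = tens a b"
proof -
  have 1: "galois (tens a b) = sweedler free_scale (\<lambda>x y. tens x (y * b)) a"
    unfolding galois_tens coord_comult_def
    by (simp add: linear_sweedler[OF linear_tens_mult_left] tens_mult_tens)
  have 2: "galois_inv (tens x (y * b)) = sweedler free_scale (\<lambda>u v. tens u (S v * (y * b))) x" for x y
    unfolding galois_inv_tens comult_antipode_def
    by (simp add: linear_sweedler[OF linear_tens_mult_left] tens_mult_tens)
  have inner: "sweedler free_scale (\<lambda>v y. tens u (S v * (y * b))) z = free_scale (\<epsilon> z) (tens u b)" for u z
  proof -
    have "sweedler free_scale (\<lambda>v y. tens u (S v * (y * b))) z
        = tens u (sweedler scale (\<lambda>v y. S v * y) z * b)"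
      by (simp add: linear_sweedler[OF linear_mult_right_const] linear_sweedler[OF linear_tens_right]
          mult.assoc)
    then show ?thesis by (simp add: sweedler_antipode_left tens_algebra)
  qed
  have "galois_inv (galois (tens a b))
      = sweedler free_scale (\<lambda>x y. sweedler free_scale (\<lambda>u v. tens u (S v * (y * b))) x) a"
    unfolding 1 linear_sweedler[OF linear_ops(2)] 2 ..
  also have "\<dots> = sweedler free_scale (\<lambda>u z. sweedler free_scale (\<lambda>v y. tens u (S v * (y * b))) z) a"
    by (rule sweedler_coassoc[OF free.vector_space_axioms])
      (simp_all add: Vector_Spaces.linear_iff vector_space_axioms free.vector_space_axioms tens_algebra)
  also have "\<dots> = sweedler free_scale (\<lambda>u z. free_scale (\<epsilon> z) (tens u b)) a"
    unfolding inner ..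
  also have "\<dots> = tens a b"
    by (rule sweedler_counit_right[OF linear_tens_left])
  finally show ?thesis .
qed

text \<open>
  \<open>a\<^sub>1 b\<^sub>1 \<otimes> a\<^sub>2 b\<^sub>2 S(b\<^sub>3) = a\<^sub>1 b\<^sub>1 \<otimes> a\<^sub>2 \<epsilon>(b\<^sub>2) = a\<^sub>1 b \<otimes> a\<^sub>2\<close>.
\<close>

lemma galois_antipode_twist_tens: "galois (antipode_twist (tens a b)) = comult_left (tens a b)"
proof -
  have assoc: "tens_mult (coord_comult (a * x)) (tens 1 c)
      = tens_mult (coord_comult a) (sweedler free_scale (\<lambda>u v. tens u (v * c)) x)" for x c
    unfolding coord_comult_mult unfolding coord_comult_def
    by (simp add: linear_sweedler[OF linear_tens_mult_left] linear_sweedler[OF linear_tens_mult_right]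
        tens_mult_tens mult.assoc)
  have inner: "sweedler free_scale (\<lambda>v y. tens u (v * S y)) z = free_scale (\<epsilon> z) (tens u 1)" for u z
    by (simp add: linear_sweedler[OF linear_tens_right, symmetric] sweedler_antipode_right tens_algebra)
  have "antipode_twist (tens a b) = sweedler free_scale (\<lambda>x y. tens (a * x) (S y)) b"
    unfolding antipode_twist_tens comult_antipode_def
    by (simp add: linear_sweedler[OF linear_tens_mult_right] tens_mult_tens)
  then have "galois (antipode_twist (tens a b)) = tens_mult (coord_comult a)
      (sweedler free_scale (\<lambda>x y. sweedler free_scale (\<lambda>u v. tens u (v * S y)) x) b)"
    by (simp add: linear_sweedler[OF linear_ops(1)] galois_tens assoc linear_sweedler[OF linear_tens_mult_right])
  also have "sweedler free_scale (\<lambda>x y. sweedler free_scale (\<lambda>u v. tens u (v * S y)) x) b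
      = sweedler free_scale (\<lambda>u z. sweedler free_scale (\<lambda>v y. tens u (v * S y)) z) b"
    by (rule sweedler_coassoc[OF free.vector_space_axioms])
      (simp_all add: Vector_Spaces.linear_iff vector_space_axioms free.vector_space_axioms tens_algebra)
  also have "sweedler free_scale (\<lambda>u z. sweedler free_scale (\<lambda>v y. tens u (v * S y)) z) b = tens b 1"
    unfolding inner
    by (rule sweedler_counit_right[OF linear_tens_left])
  finally show ?thesis by (simp add: comult_left_tens)
qed

definition id_antipode where "id_antipode = tens_lift (\<lambda>a b. tens a (S b))"

lemma id_antipode_tens: "id_antipode (tens a b) = tens a (S b)"
  unfolding id_antipode_def by (rule free_extend_tens[OF bilinear_tens_antipode])

lemma linear_id_antipode: "Vector_Spaces.linear free_scale free_scale id_antipode"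
  unfolding id_antipode_def by (rule linear_tens_lift)

lemma id_antipode_degree_filt:
  assumes "w \<in> degree_filt 0 m" shows "id_antipode w \<in> degree_filt 0 m"
  using assms linear_id_antipode subspace_degree_filt
  by (rule degree_filt_induct) (auto simp: id_antipode_tens intro!: degree_filt_tens antipode_graded)

lemma linear_endo_diff:
  assumes "Vector_Spaces.linear free_scale free_scale f" "Vector_Spaces.linear free_scale free_scale g"
  shows "Vector_Spaces.linear free_scale free_scale (\<lambda>w. f w - g w)"
  using assms unfolding Vector_Spaces.linear_iff by (simp add: free.scale_right_diff_distrib)

text \<open>
  The term with \<open>b\<^sub>1 = 1\<close> is \<open>a \<otimes> S(b)\<close>; in all other terms \<open>b\<^sub>1\<close> has positive degree, so \<open>a b\<^sub>1\<close> has a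
  higher degree than \<open>a\<close>.
\<close>

lemma antipode_twist_raises:
  assumes "w \<in> degree_filt n m" shows "antipode_twist w - id_antipode w \<in> degree_filt (Suc n) m"
  using assms linear_endo_diff[OF linear_ops(4) linear_id_antipode] subspace_degree_filt
proof (rule degree_filt_induct)
  fix a b p q assume *: "n \<le> p" "p + q = m" "a \<in> H p" "b \<in> H q"
  have bil: "bilinear_map scale free_scale (\<lambda>x y. tens (a * x) (S y))"
    by (rule bilinear_mapI[OF free.vector_space_axioms]) (simp_all add: tens_algebra)
  have eq: "antipode_twist (tens a b) = sweedler free_scale (\<lambda>x y. tens (a * x) (S y)) b"
    unfolding antipode_twist_tens comult_antipode_def
    by (simp add: linear_sweedler[OF linear_tens_mult_right] tens_mult_tens)
  have "sweedler free_scale (\<lambda>x y. tens (a * x) (S y)) b - tens (a * 1) (S b) \<in> degree_filt (Suc n) m"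
  proof (rule sweedler_minus_left_unit_term[OF bil subspace_degree_filt *(4)])
    fix p' q' x y assume "0 < p'" "p' + q' = q" "x \<in> H p'" "y \<in> H q'"
    then show "tens (a * x) (S y) \<in> degree_filt (Suc n) m"
      using * by (intro degree_filt_tens[OF mult_graded antipode_graded]) auto
  qed
  then show "antipode_twist (tens a b) - id_antipode (tens a b) \<in> degree_filt (Suc n) m"
    by (simp add: eq id_antipode_tens)
qed

lemma galois_length_filt:
  assumes "w \<in> length_filt n m" shows "galois w \<in> length_filt n m"
  using assms linear_ops(1) subspace_length_filt
proof (rule length_filt_induct)
  fix x y i j p q assume *: "positive_product i p x" "positive_product j q y" "n \<le> i + j" "p + q = m"
  have "tens_mult (coord_comult x) (tens 1 y) \<in> length_filt (i + j) (p + q)"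
    by (rule tens_mult_length_filt[OF coord_comult_length_filt[OF *(1)] length_filt_tens[OF positive_product.empty *(2)]]) auto
  then show "galois (tens x y) \<in> length_filt n m"
    unfolding galois_tens using length_filt_mono[OF *(3)] *(4) by blast
qed

text \<open>
  The difference is \<open>(\<Delta> a - \<tau> \<Delta> a) (b \<otimes> 1)\<close>.
\<close>

lemma comult_left_raises:
  assumes "w \<in> length_filt n m" shows "comult_left w - swap (galois w) \<in> length_filt (Suc n) m"
  using assms linear_endo_diff[OF linear_ops(3) Vector_Spaces.linear_compose[OF linear_ops(1) linear_swap, unfolded o_def]] subspace_length_filt
proof (rule length_filt_induct)
  fix x y i j p q assume *: "positive_product i p x" "positive_product j q y" "n \<le> i + j" "p + q = m"
  have "swap (galois (tens x y)) = tens_mult (swap (coord_comult x)) (tens y 1)"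
    unfolding galois_tens coord_comult_def
    by (simp add: linear_sweedler[OF linear_tens_mult_left] linear_sweedler[OF linear_swap] tens_mult_tens swap_tens)
  then have "comult_left (tens x y) - swap (galois (tens x y)) = tens_mult (coord_comult x - swap (coord_comult x)) (tens y 1)"
    by (simp add: comult_left_tens module_hom.diff[OF linear_tens_mult_left[unfolded linear_iff_module_hom]])
  also have "\<dots> \<in> length_filt (Suc i + j) (p + q)"
    by (rule tens_mult_length_filt[OF coord_comult_cocommutative_mod_length_filt[OF *(1)] length_filt_tens[OF *(2) positive_product.empty]]) auto
  finally show "comult_left (tens x y) - swap (galois (tens x y)) \<in> length_filt (Suc n) m"
    using length_filt_mono[of "Suc n" "Suc i + j"] * by auto
qed

section \<open>The two traces\<close>

text \<open>
  The pairs of basis vectors of total degree \<open>m\<close>, which index a basis of the component of degree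
  \<open>m\<close> of \<open>H \<otimes> H\<close>.
\<close>

definition pairs :: "nat \<Rightarrow> ('h \<times> 'h) set" where
  "pairs m = (\<Union>p\<in>{..m}. basis p \<times> basis (m - p))"

lemma finite_pairs: "finite (pairs m)"
  unfolding pairs_def by (simp add: finite_basis)

lemma tens_pairs: "(x, y) \<in> pairs m \<Longrightarrow> gen (x, y) = tens x y"
  by (rule tens_basis[symmetric]) (auto simp: pairs_def full_basis_def)

lemma span_pairs: "free.span (gen ` pairs m) = degree_filt 0 m"
proof
  show "free.span (gen ` pairs m) \<subseteq> degree_filt 0 m"
  proof (rule free.span_minimal[OF _ subspace_degree_filt], safe)
    fix x y assume "(x, y) \<in> pairs m"
    then show "gen (x, y) \<in> degree_filt 0 m"
      unfolding tens_pairs[OF \<open>(x, y) \<in> pairs m\<close>] pairs_def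
      using basis_subset by (auto intro!: degree_filt_tens)
  qed
  show "degree_filt 0 m \<subseteq> free.span (gen ` pairs m)"
    unfolding degree_filt_def
  proof (rule free.span_minimal[OF _ free.subspace_span], safe)
    fix a b p q assume *: "a \<in> H p" "b \<in> H q" and m: "m = p + q"
    have "tens x y \<in> free.span (gen ` pairs (p + q))" if "x \<in> basis p" "y \<in> basis q" for x y
    proof -
      have "(x, y) \<in> pairs (p + q)" using that unfolding pairs_def by force
      then show ?thesis by (simp add: tens_pairs[symmetric] free.span_base)
    qed
    then have "tens x b \<in> free.span (gen ` pairs (p + q))" if "x \<in> basis p" for x
      using linear_span_in_subspace[OF linear_tens_right, of b "basis q"] *(2) span_basis that by simp
    then show "tens a b \<in> free.span (gen ` pairs (p + q))"
      using linear_span_in_subspace[OF linear_tens_left, of a "basis p"] *(1) span_basis by simp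
  qed
qed

lemma sum_pairs: "(\<Sum>z\<in>pairs m. g z) = (\<Sum>p\<le>m. \<Sum>x\<in>basis p. \<Sum>y\<in>basis (m - p). g (x, y))"
proof -
  have "(\<Sum>z\<in>pairs m. g z) = (\<Sum>p\<le>m. \<Sum>z\<in>basis p \<times> basis (m - p). g z)"
    unfolding pairs_def
    by (rule sum.UNION_disjoint) (use finite_basis basis_disjoint in auto)
  then show ?thesis by (simp add: sum.cartesian_product)
qed

lemma trace_id_antipode:
  "trace_wrt free_scale (gen ` pairs m) id_antipode
    = (\<Sum>p\<le>m. of_nat (card (basis p)) * trace_wrt scale (basis (m - p)) S)"
proof -
  have "trace_wrt free_scale (gen ` pairs m) id_antipode
      = (\<Sum>z\<in>pairs m. Poly_Mapping.lookup (id_antipode (gen z)) z)"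
    by (intro trace_wrt_gen finite_pairs) (metis id_antipode_degree_filt span_pairs free.span_base image_eqI)
  also have "\<dots> = (\<Sum>(x, y)\<in>pairs m. coord x x * coord (S y) y)"
    by (rule sum.cong) (auto simp: tens_pairs id_antipode_tens lookup_tens)
  also have "\<dots> = (\<Sum>p\<le>m. \<Sum>x\<in>basis p. \<Sum>y\<in>basis (m - p). representation (basis (m - p)) (S y) y)"
    unfolding sum_pairs
  proof (intro sum.cong refl)
    fix p x y assume xy: "x \<in> basis p" "y \<in> basis (m - p)"
    have "x \<in> full_basis" using xy(1) by (auto simp: full_basis_def)
    then have "coord x x = 1" using representation_basis[OF independent_full_basis, of x] by simp
    moreover have "coord (S y) = representation (basis (m - p)) (S y)"
      by (rule coord_component[OF antipode_graded]) (use xy(2) basis_subset in blast)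
    ultimately show "(case (x, y) of (x, y) \<Rightarrow> coord x x * coord (S y) y) = representation (basis (m - p)) (S y) y"
      by simp
  qed
  finally show ?thesis unfolding trace_wrt_def by simp
qed

lemma trace_swap:
  "trace_wrt free_scale (gen ` pairs m) swap
    = (if even m then of_nat (card (basis (m div 2))) else 0)"
proof -
  have "swap w \<in> degree_filt 0 m" if "w \<in> degree_filt 0 m" for w
    using swap_length_filt[of w 0 m] that by (simp add: length_filt_0)
  then have "trace_wrt free_scale (gen ` pairs m) swap
      = (\<Sum>z\<in>pairs m. Poly_Mapping.lookup (swap (gen z)) z)"
    by (intro trace_wrt_gen finite_pairs) (metis span_pairs free.span_base image_eqI)
  also have "\<dots> = (\<Sum>(x, y)\<in>pairs m. if x = y then 1 else 0)"
  proof (intro sum.cong refl, clarify)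
    fix x y assume xy: "(x, y) \<in> pairs m"
    then have "tens y x = gen (y, x)" by (intro tens_basis) (auto simp: pairs_def full_basis_def)
    then show "Poly_Mapping.lookup (swap (gen (x, y))) (x, y) = (if x = y then 1 else 0)"
      by (simp add: tens_pairs[OF xy] swap_tens lookup_single when_def)
  qed
  also have "\<dots> = (\<Sum>p\<le>m. if p = m - p then of_nat (card (basis p)) else 0)"
    unfolding sum_pairs
  proof (rule sum.cong[OF refl])
    fix p
    show "(\<Sum>x\<in>basis p. \<Sum>y\<in>basis (m - p). case (x, y) of (x, y) \<Rightarrow> if x = y then 1 else 0)
        = (if p = m - p then of_nat (card (basis p)) else 0 :: 'k)"
    proof (cases "p = m - p")
      case True
      then show ?thesis using finite_basis[of p] by simp
    next
      case False
      then have "x \<noteq> y" if "x \<in> basis p" "y \<in> basis (m - p)" for x y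
        using basis_disjoint[of p "m - p"] that by auto
      then show ?thesis using False by (auto intro!: sum.neutral)
    qed
  qed
  also have "\<dots> = (\<Sum>p\<in>{..m}. if p = m div 2 \<and> even m then of_nat (card (basis p)) else 0)"
    by (rule sum.cong) (auto, presburger+)
  also have "\<dots> = (if even m then of_nat (card (basis (m div 2))) else 0)"
    by (cases "even m") simp_all
  finally show ?thesis .
qed

lemma galois_inv_galois:
  assumes "w \<in> degree_filt 0 m" shows "galois_inv (galois w) = w"
proof -
  have "galois_inv (galois w) - w \<in> {0}"
    using assms linear_endo_diff[OF Vector_Spaces.linear_compose[OF linear_ops(1,2), unfolded o_def] free.linear_ident]
  by (rule degree_filt_induct) (simp_all add: galois_inv_galois_tens)
  then show ?thesis by simp
qed

text \<open>
  Since \<open>galois\<close> has a left inverse and each level of the filtration is finite-dimensional, it is onto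
  each level; hence \<open>galois_inv\<close> preserves the filtration too.
\<close>

lemma galois_image_length_filt: "galois ` length_filt n m = length_filt n m"
proof -
  obtain A where A: "A \<subseteq> length_filt n m" "free.independent A" "length_filt n m \<subseteq> free.span A"
    using free.maximal_independent_subset .
  have span: "free.span A = length_filt n m"
    using A(3) free.span_minimal[OF A(1) subspace_length_filt] by blast
  have sub: "length_filt n m \<subseteq> degree_filt 0 m" using length_filt_mono[of 0 n] length_filt_0 by blast
  have "finite A"
    using free.independent_span_bound[of "gen ` pairs m" A] finite_pairs A(1,2) sub span_pairs by auto
  moreover have "inj_on galois (length_filt n m)"
    by (rule inj_on_inverseI[of _ galois_inv]) (use sub galois_inv_galois in blast)
  ultimately show ?thesis
    using free.injective_endo_surjective_on_span[of A galois] linear_ops(1) galois_length_filt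
    by (auto simp: span)
qed

lemma galois_inv_length_filt:
  assumes "w \<in> length_filt n m" shows "galois_inv w \<in> length_filt n m"
proof -
  obtain v where "v \<in> length_filt n m" "w = galois v" using assms galois_image_length_filt by blast
  moreover have "v \<in> degree_filt 0 m" using calculation(1) length_filt_mono[of 0 n] length_filt_0 by blast
  ultimately show ?thesis using galois_inv_galois by simp
qed

text \<open>
  The chain \<open>trace (id \<otimes> S) = trace U = trace (\<gamma> X) = trace (\<gamma> \<tau> \<beta>) = trace (\<tau> \<beta> \<gamma>) = trace \<tau>\<close>.
\<close>

lemma trace_id_antipode_eq_trace_swap:
  "trace_wrt free_scale (gen ` pairs m) id_antipode = trace_wrt free_scale (gen ` pairs m) swap"
proof -
  let ?A = "gen ` pairs m" let ?tr = "trace_wrt free_scale ?A"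
  have A: "finite ?A" "free.independent ?A" "free.span ?A = degree_filt 0 m"
    using finite_pairs independent_gen span_pairs by auto
  have in_A: "b \<in> degree_filt 0 m" if "b \<in> ?A" for b using A(3) that free.span_base by metis
  have stable: "galois w \<in> degree_filt 0 m" "swap w \<in> degree_filt 0 m" "galois_inv w \<in> degree_filt 0 m"
      "id_antipode w \<in> degree_filt 0 m" if "w \<in> degree_filt 0 m" for w
    using galois_length_filt[of w 0] swap_length_filt[of w 0] galois_inv_length_filt[of w 0] id_antipode_degree_filt[of w] that
    by (simp_all add: length_filt_0)
  note lin = Vector_Spaces.linear_compose[unfolded o_def]
  note swap_galois = lin[OF linear_ops(1) linear_swap]
  have "?tr antipode_twist = ?tr id_antipode"
    by (rule free.trace_wrt_eq_if_diff_raises[where F = "\<lambda>n. degree_filt n m" and N = "Suc m" and A = ?A])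
      (use A stable degree_filt_mono degree_filt_bounded antipode_twist_raises linear_ops linear_id_antipode in auto)
  moreover have "?tr antipode_twist = ?tr (\<lambda>w. galois_inv (comult_left w))"
    unfolding trace_wrt_def
  proof (rule sum.cong[OF refl])
    have "galois_inv (comult_left w) = antipode_twist w" if "w \<in> degree_filt 0 m" for w
    proof -
      have "antipode_twist w - id_antipode w \<in> degree_filt 0 m"
        using antipode_twist_raises[OF that] degree_filt_mono[of 0 1] by auto
      then have "antipode_twist w \<in> degree_filt 0 m"
        using free.subspace_add[OF subspace_degree_filt _ stable(4)[OF that]] by fastforce
      moreover have "galois (antipode_twist w) - comult_left w \<in> {0}"
        using that linear_endo_diff[OF lin[OF linear_ops(4,1)] linear_ops(3)]
        by (rule degree_filt_induct) (simp_all add: galois_antipode_twist_tens)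
      ultimately show ?thesis using galois_inv_galois by force
    qed
    then show "free.representation ?A (antipode_twist b) b
        = free.representation ?A (galois_inv (comult_left b)) b" if "b \<in> ?A" for b
      using in_A[OF that] by simp
  qed
  moreover have "?tr (\<lambda>w. galois_inv (comult_left w)) = ?tr (\<lambda>w. galois_inv (swap (galois w)))"
  proof (rule free.trace_wrt_eq_if_diff_raises[where F = "\<lambda>n. length_filt n m" and N = "Suc m" and A = ?A])
    fix n w assume "w \<in> length_filt n m"
    then have "galois_inv (comult_left w - swap (galois w)) \<in> length_filt (Suc n) m"
      by (intro galois_inv_length_filt comult_left_raises)
    then show "galois_inv (comult_left w) - galois_inv (swap (galois w)) \<in> length_filt (Suc n) m"
      by (simp add: module_hom.diff[OF linear_ops(2)[unfolded linear_iff_module_hom]])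
  next
    show "length_filt (Suc n) m \<subseteq> length_filt n m" for n by (rule length_filt_mono) simp
  qed (use A stable length_filt_bounded length_filt_0 lin[OF linear_ops(3,2)] lin[OF swap_galois linear_ops(2)] in auto)
  moreover have "?tr (\<lambda>w. galois_inv (swap (galois w))) = ?tr (\<lambda>w. swap (galois (galois_inv w)))"
    by (rule free.trace_wrt_cyclic[OF A(1,2) A(1,2) linear_ops(2) swap_galois])
      (use A(3) stable in auto)
  \<comment> \<open>The left inverse \<open>galois_inv\<close> is also a right inverse, because \<open>galois\<close> is onto.\<close>
  moreover have "?tr (\<lambda>w. swap (galois (galois_inv w))) = ?tr swap"
    unfolding trace_wrt_def
  proof (rule sum.cong[OF refl])
    have "galois (galois_inv w) = w" if "w \<in> degree_filt 0 m" for w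
    proof -
      have "w \<in> galois ` degree_filt 0 m" using that galois_image_length_filt[of 0 m] by (simp add: length_filt_0)
      then obtain v where "v \<in> degree_filt 0 m" "w = galois v" by blast
      then show ?thesis using galois_inv_galois by simp
    qed
    then show "free.representation ?A (swap (galois (galois_inv b))) b
        = free.representation ?A (swap b) b" if "b \<in> ?A" for b
      using in_A[OF that] by simp
  qed
  ultimately show ?thesis by simp
qed

lemma sum_dim_trace_antipode:
  "(\<Sum>p\<le>m. of_nat (card (basis p)) * trace_wrt scale (basis (m - p)) S)
    = (if even m then of_nat (card (basis (m div 2))) else 0)"
  using trace_id_antipode trace_id_antipode_eq_trace_swap trace_swap by simp

end

section \<open>The generating function\<close>

lemma fps_compose_X_square_nth:
  "fps_nth (f oo fps_X ^ 2) n = (if even n then fps_nth f (n div 2) else (0 :: 'a::comm_ring_1))"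
proof -
  have "fps_nth (f oo fps_X ^ 2) n = (\<Sum>i=0..n. if i = n div 2 \<and> even n then fps_nth f i else 0)"
    unfolding fps_compose_nth power_mult[symmetric]
    by (rule sum.cong) auto
  then show ?thesis by (cases "even n") auto
qed

theorem corollary13:
  fixes scale :: "'k::field_char_0 \<Rightarrow> 'h::ring_1 \<Rightarrow> 'h"
    and \<Delta> :: "'h \<Rightarrow> ('h \<times> 'h \<Rightarrow>\<^sub>0 'k) set"
    and \<epsilon> :: "'h \<Rightarrow> 'k"
    and H :: "nat \<Rightarrow> 'h set"
    and S :: "'h \<Rightarrow> 'h"
    and h :: "'k fps"
  assumes "graded_connected_hopf_algebra scale \<Delta> \<epsilon> H"
    and "\<And>m. \<exists>B. finite B \<and> module.span scale B = H m"
    and "bialgebra.is_antipode scale \<Delta> \<epsilon> S"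
    and "h = 1 + Abs_fps (\<lambda>m. if m \<ge> 1 then of_nat (vector_space.dim scale (H m)) else 0)"
  shows "Abs_fps (\<lambda>m. vector_space.trace_on scale (H m) S) = (h oo fps_X ^ 2) / h"
proof -
  interpret graded_connected_hopf_algebra scale \<Delta> \<epsilon> H by fact
  \<comment> \<open>Literally the choice made by \<open>trace_on\<close>, so that its value is the diagonal sum over this basis.\<close>
  define basis where "basis m = (SOME B. B \<subseteq> H m \<and> independent B \<and> H m \<subseteq> span B)" for m
  have basis: "basis m \<subseteq> H m \<and> independent (basis m) \<and> H m \<subseteq> span (basis m)" for m
    unfolding basis_def
  proof (rule someI_ex)
    obtain B where "B \<subseteq> H m" "independent B" "H m \<subseteq> span B" by (rule maximal_independent_subset)
    then show "\<exists>B. B \<subseteq> H m \<and> independent B \<and> H m \<subseteq> span B" by blast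
  qed
  have trace: "trace_on (H m) S = trace_wrt scale (basis m) S" for m
    unfolding trace_on_def trace_wrt_def basis_def Let_def ..
  interpret graded_hopf_algebra_with_basis scale \<Delta> \<epsilon> H basis S
  proof
    fix m
    obtain A where "finite A" "span A = H m" using assms(2) by blast
    then show "finite (basis m)" using independent_span_bound[of A "basis m"] basis by auto
    show "independent (basis m)" using basis by blast
    show "span (basis m) = H m"
      using basis[of m] span_minimal[of "basis m" "H m"] subspace_component by blast
  qed (rule assms(3))
  have dim: "dim (H m) = card (basis m)" for m
    using basis_card_eq_dim[of "basis m" "H m"] basis by simp
  have h: "fps_nth h m = of_nat (card (basis m))" for m
    using connected by (cases "m = 0") (simp_all add: assms(4) dim[symmetric])
  have "Abs_fps (\<lambda>m. trace_on (H m) S) * h = h oo fps_X ^ 2"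
  proof (rule fps_ext)
    fix m
    have "fps_nth (h * Abs_fps (\<lambda>m. trace_on (H m) S)) m
        = (\<Sum>p\<le>m. of_nat (card (basis p)) * trace_wrt scale (basis (m - p)) S)"
      by (simp add: fps_mult_nth h trace atMost_atLeast0)
    also have "\<dots> = fps_nth (h oo fps_X ^ 2) m"
      by (simp add: sum_dim_trace_antipode fps_compose_X_square_nth h)
    finally show "fps_nth (Abs_fps (\<lambda>m. trace_on (H m) S) * h) m = fps_nth (h oo fps_X ^ 2) m"
      by (simp add: mult.commute)
  qed
  moreover have "fps_nth h 0 \<noteq> 0" using h[of 0] dim[of 0] connected by simp
  ultimately show ?thesis by (metis fps_divide_times_eq fps_nonzero_nth nonzero_mult_div_cancel_right)
qed

end
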